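(* A smooth function $f:\mathbb{S}^J\to\mathbb{R}$ on the Siegel-Jacobi space is a Kähler function if and only if there exists $L\in\mathfrak{g}^J$ such that $f=\mathbf{J}^L$, where $\mathbf{J}:\mathbb{S}^J\to(\mathfrak{g}^J)^*$ is the momentum map of the action of the Jacobi group $G^J(\mathbb{R})$ specified in the context and $\mathbf{J}^L(p)=\mathbf{J}(p)(L)$.
   Context: The Siegel-Jacobi space $\mathbb{S}^J$ is the complex manifold $\mathbb{H}\times\mathbb{C}$ ($\mathbb{H}$ the upper half-plane) with the Kähler metric $g_{KB}$ whose matrix in the coordinates $(u,v,x,y)$ ($\tau=u+iv\in\mathbb{H}$, $z=x+iy\in\mathbb{C}$) is $$\frac12\begin{bmatrix}\frac{v+y^2}{v^3}&0&-\frac{y}{v^2}&0\\0&\frac{v+y^2}{v^3}&0&-\frac{y}{v^2}\\-\frac{y}{v^2}&0&\frac1v&0\\0&-\frac{y}{v^2}&0&\frac1v\end{bmatrix},$$ and symplectic form $\omega_{KB}=g_{KB}(J\cdot,\cdot)$, $J$ being the complex structure. Coordinates $(\theta_1,\theta_2,\dot\theta_1,\dot\theta_2)$ on $\mathbb{S}^J$ ($\theta_2<0$) are defined by $\tau=\dot\theta_2-i\theta_2$, $z=-\dot\theta_1+i\theta_1$, and $\eta_1=-\frac{\theta_1}{2\theta_2}$, $\eta_2=\frac{\theta_1^2-2\theta_2}{4\theta_2^2}$. A smooth function $f$ on a Kähler manifold $(N,g,J,\omega)$ is a Kähler function if $\mathscr{L}_{X_f}g=0$, where $X_f$ is defined by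 $\omega(X_f,\cdot)=df$. $\mathfrak{g}^J=\mathfrak{sl}(2,\mathbb{R})\times\mathbb{R}^2\times\mathbb{R}$ is the Lie algebra of the Jacobi group, with basis $F=\big[\begin{smallmatrix}0&1\\0&0\end{smallmatrix}\big]$, $G=\big[\begin{smallmatrix}0&0\\1&0\end{smallmatrix}\big]$, $H=\big[\begin{smallmatrix}1&0\\0&-1\end{smallmatrix}\big]$ in $\mathfrak{sl}(2,\mathbb{R})$, and $P=(1,0,0)$, $Q=(0,1,0)$, $R=(0,0,1)$ in $\mathbb{R}^2\times\mathbb{R}$. The momentum map $\mathbf{J}$ is determined by linearity of $L\mapsto\mathbf{J}^L$ and $\mathbf{J}^F=-\eta_2$, $\mathbf{J}^G=\frac14\dot\theta_1^2+\eta_2\dot\theta_2^2+\eta_1\dot\theta_1\dot\theta_2-\frac{1}{4(\eta_1^2-\eta_2)}$, $\mathbf{J}^H=-\eta_1\dot\theta_1-2\eta_2\dot\theta_2$, $\mathbf{J}^P=\frac12\dot\theta_1+\eta_1\dot\theta_2$, $\mathbf{J}^Q=\eta_1$, $\mathbf{J}^R=-\frac14$. *)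

theory Defs
  imports "HOL-Analysis.Analysis"
begin

section \<open>Smooth maps, Lie derivative of a metric, and Kaehler functions\<close>

text \<open>
  All manifolds here are open subsets \<open>N\<close> of a real normed vector space, so every tangent space is
  that vector space itself. Functions and vector fields are total, but only their values on \<open>N\<close>
  are relevant: since \<open>N\<close> is open, derivatives at points of \<open>N\<close> do not see the values outside.
\<close>

fun higher_differentiable_on ::
  "'a::real_normed_vector set \<Rightarrow> ('a \<Rightarrow> 'b::real_normed_vector) \<Rightarrow> nat \<Rightarrow> bool" where
  "higher_differentiable_on S f 0 \<longleftrightarrow> continuous_on S f"
| "higher_differentiable_on S f (Suc n) \<longleftrightarrow>
     (\<forall>x\<in>S. f differentiable (at x)) \<and>
     (\<forall>v. higher_differentiable_on S (\<lambda>x. frechet_derivative f (at x) v) n)"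

definition smooth_on :: "'a::real_normed_vector set \<Rightarrow> ('a \<Rightarrow> 'b::real_normed_vector) \<Rightarrow> bool" where
  "smooth_on S f \<longleftrightarrow> (\<forall>n. higher_differentiable_on S f n)"

definition lie_bracket ::
  "('a::real_normed_vector \<Rightarrow> 'a) \<Rightarrow> ('a \<Rightarrow> 'a) \<Rightarrow> 'a \<Rightarrow> 'a" where
  "lie_bracket X Y p = frechet_derivative Y (at p) (X p) - frechet_derivative X (at p) (Y p)"

text \<open>\<open>(L\<^sub>X g)(Y,Z) = X(g(Y,Z)) - g([X,Y],Z) - g(Y,[X,Z])\<close>.\<close>

definition lie_derivative ::
  "('a::real_normed_vector \<Rightarrow> 'a) \<Rightarrow> ('a \<Rightarrow> 'a \<Rightarrow> 'a \<Rightarrow> real) \<Rightarrow>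
     ('a \<Rightarrow> 'a) \<Rightarrow> ('a \<Rightarrow> 'a) \<Rightarrow> 'a \<Rightarrow> real" where
  "lie_derivative X g Y Z p =
     frechet_derivative (\<lambda>q. g q (Y q) (Z q)) (at p) (X p)
     - g p (lie_bracket X Y p) (Z p) - g p (Y p) (lie_bracket X Z p)"

text \<open>The vector field \<open>X\<^sub>f\<close> with \<open>\<omega>(X\<^sub>f, \<cdot>) = df\<close>; meaningful where \<open>\<omega>\<close> is nondegenerate.\<close>

definition hamiltonian_vector_field ::
  "('a::real_normed_vector \<Rightarrow> 'a \<Rightarrow> 'a \<Rightarrow> real) \<Rightarrow> ('a \<Rightarrow> real) \<Rightarrow> 'a \<Rightarrow> 'a" where
  "hamiltonian_vector_field \<omega> f p = (THE X. \<forall>Y. \<omega> p X Y = frechet_derivative f (at p) Y)"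

definition kaehler_function ::
  "'a::real_normed_vector set \<Rightarrow> ('a \<Rightarrow> 'a \<Rightarrow> 'a \<Rightarrow> real) \<Rightarrow> ('a \<Rightarrow> 'a \<Rightarrow> 'a \<Rightarrow> real) \<Rightarrow>
     ('a \<Rightarrow> real) \<Rightarrow> bool" where
  "kaehler_function N g \<omega> f \<longleftrightarrow>
     smooth_on N f \<and>
     (\<forall>Y Z. smooth_on N Y \<longrightarrow> smooth_on N Z \<longrightarrow>
        (\<forall>p\<in>N. lie_derivative (hamiltonian_vector_field \<omega> f) g Y Z p = 0))"


section \<open>The Siegel-Jacobi space\<close>

definition siegel_jacobi_space :: "(complex \<times> complex) set" where
  "siegel_jacobi_space = {(\<tau>, z). Im \<tau> > 0}"

text \<open>Coordinates \<open>(u, v, x, y)\<close>, both of points and of tangent vectors.\<close>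

definition real_coords :: "complex \<times> complex \<Rightarrow> real ^ 4" where
  "real_coords w = vector [Re (fst w), Im (fst w), Re (snd w), Im (snd w)]"

definition KB_matrix :: "complex \<times> complex \<Rightarrow> real ^ 4 ^ 4" where
  "KB_matrix p = (let v = Im (fst p); y = Im (snd p) in
     (1/2) *\<^sub>R vector
       [vector [(v + y^2) / v^3, 0, - y / v^2, 0],
        vector [0, (v + y^2) / v^3, 0, - y / v^2],
        vector [- y / v^2, 0, 1 / v, 0],
        vector [0, - y / v^2, 0, 1 / v]])"

definition g_KB :: "complex \<times> complex \<Rightarrow> complex \<times> complex \<Rightarrow> complex \<times> complex \<Rightarrow> real" where
  "g_KB p X Y = real_coords X \<bullet> (KB_matrix p *v real_coords Y)"

definition complex_structure :: "complex \<times> complex \<Rightarrow> complex \<times> complex" where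
  "complex_structure X = (\<i> * fst X, \<i> * snd X)"

definition omega_KB :: "complex \<times> complex \<Rightarrow> complex \<times> complex \<Rightarrow> complex \<times> complex \<Rightarrow> real" where
  "omega_KB p X Y = g_KB p (complex_structure X) Y"

lemma vector_4:
  "(vector [a, b, c, d] :: 'a::zero ^ 4) $ 1 = a"
  "(vector [a, b, c, d] :: 'a::zero ^ 4) $ 2 = b"
  "(vector [a, b, c, d] :: 'a::zero ^ 4) $ 3 = c"
  "(vector [a, b, c, d] :: 'a::zero ^ 4) $ 4 = d"
  unfolding vector_def by simp_all

lemma g_KB_eq:
  "g_KB p X Y =
    ((Im (fst p) + (Im (snd p))^2) / (Im (fst p))^3
        * (Re (fst X) * Re (fst Y) + Im (fst X) * Im (fst Y))
     - Im (snd p) / (Im (fst p))^2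
        * (Re (fst X) * Re (snd Y) + Im (fst X) * Im (snd Y)
           + Re (snd X) * Re (fst Y) + Im (snd X) * Im (fst Y))
     + 1 / Im (fst p) * (Re (snd X) * Re (snd Y) + Im (snd X) * Im (snd Y))) / 2"
  by (simp add: g_KB_def KB_matrix_def real_coords_def Let_def inner_vec_def
      matrix_vector_mult_def sum_4 vector_4 algebra_simps add_divide_distrib diff_divide_distrib)

text \<open>The defining equation of \<open>X\<^sub>f\<close> is uniquely solvable on the Siegel-Jacobi space.\<close>

lemma omega_KB_nondegenerate:
  assumes "p \<in> siegel_jacobi_space" and "linear d"
  shows "\<exists>!X. \<forall>Y. omega_KB p X Y = d Y"
proof -
  define v where "v = Im (fst p)"
  define y where "y = Im (snd p)"
  have v: "v > 0"
    using assms(1) by (auto simp: siegel_jacobi_space_def v_def)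
  define a b k l where "a = d (1, 0)" and "b = d (\<i>, 0)" and "k = d (0, 1)" and "l = d (0, \<i>)"
  have d: "d Y = a * Re (fst Y) + b * Im (fst Y) + k * Re (snd Y) + l * Im (snd Y)" for Y
  proof -
    have "Y = Re (fst Y) *\<^sub>R (1, 0) + Im (fst Y) *\<^sub>R (\<i>, 0) + Re (snd Y) *\<^sub>R (0, 1) + Im (snd Y) *\<^sub>R (0, \<i>)"
      by (auto simp: prod_eq_iff complex_eq_iff)
    then have "d Y = d (Re (fst Y) *\<^sub>R (1, 0) + Im (fst Y) *\<^sub>R (\<i>, 0) + Re (snd Y) *\<^sub>R (0, 1) + Im (snd Y) *\<^sub>R (0, \<i>))"
      by simp
    also have "\<dots> = Re (fst Y) * a + Im (fst Y) * b + Re (snd Y) * k + Im (snd Y) * l"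
      by (simp only: linear_add[OF assms(2)] linear_scale[OF assms(2)] a_def b_def k_def l_def real_scaleR_def)
    finally show ?thesis by (simp add: mult.commute)
  qed
  have om: "omega_KB p X Y =
     ((v + y^2) / v^3 * (Re (fst X) * Im (fst Y) - Im (fst X) * Re (fst Y))
      - y / v^2 * (Re (fst X) * Im (snd Y) - Im (fst X) * Re (snd Y)
                   + Re (snd X) * Im (fst Y) - Im (snd X) * Re (fst Y))
      + 1 / v * (Re (snd X) * Im (snd Y) - Im (snd X) * Re (snd Y))) / 2" for X Y
    unfolding omega_KB_def g_KB_eq complex_structure_def v_def y_def by (simp add: algebra_simps)
  show ?thesis
  proof (rule ex1I)
    let ?X = "(Complex (2 * (v^2 * b + v * y * l)) (- 2 * (v^2 * a + v * y * k)),
               Complex (2 * (v * y * b + (v + y^2) * l)) (- 2 * (v * y * a + (v + y^2) * k)))"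
    show "\<forall>Y. omega_KB p ?X Y = d Y"
      unfolding om d using v by (simp add: field_simps power2_eq_square power3_eq_cube)
    fix X assume X: "\<forall>Y. omega_KB p X Y = d Y"
    have e: "- (v + y^2) / v^3 * Im (fst X) + y / v^2 * Im (snd X) = 2 * a"
         "(v + y^2) / v^3 * Re (fst X) - y / v^2 * Re (snd X) = 2 * b"
         "y / v^2 * Im (fst X) - 1 / v * Im (snd X) = 2 * k"
         "- y / v^2 * Re (fst X) + 1 / v * Re (snd X) = 2 * l"
      using X[rule_format, of "(1,0)"] X[rule_format, of "(\<i>,0)"]
            X[rule_format, of "(0,1)"] X[rule_format, of "(0,\<i>)"]
      unfolding om d by (simp_all add: algebra_simps)
    have "Re (fst X) = v^2 * (2 * b) + v * y * (2 * l)"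
         "Im (fst X) = - (v^2 * (2 * a) + v * y * (2 * k))"
         "Re (snd X) = v * y * (2 * b) + (v + y^2) * (2 * l)"
         "Im (snd X) = - (v * y * (2 * a) + (v + y^2) * (2 * k))"
      unfolding e[symmetric] using v by (simp_all add: field_simps power2_eq_square power3_eq_cube)
    then show "X = ?X"
      by (simp add: prod_eq_iff complex_eq_iff algebra_simps)
  qed
qed

text \<open>The coordinates \<open>(\<theta>\<^sub>1, \<theta>\<^sub>2, d\<theta>\<^sub>1, d\<theta>\<^sub>2)\<close>; \<open>d\<theta>\<^sub>i\<close> stands for \<open>\<theta>\<^sub>i\<close> with a dot.\<close>

definition \<theta>\<^sub>1 :: "complex \<times> complex \<Rightarrow> real" where "\<theta>\<^sub>1 p = Im (snd p)"
definition \<theta>\<^sub>2 :: "complex \<times> complex \<Rightarrow> real" where "\<theta>\<^sub>2 p = - Im (fst p)"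
definition d\<theta>\<^sub>1 :: "complex \<times> complex \<Rightarrow> real" where "d\<theta>\<^sub>1 p = - Re (snd p)"
definition d\<theta>\<^sub>2 :: "complex \<times> complex \<Rightarrow> real" where "d\<theta>\<^sub>2 p = Re (fst p)"

lemma theta_coordinates:
  "(\<tau>, z) = p \<longleftrightarrow>
     \<tau> = complex_of_real (d\<theta>\<^sub>2 p) - \<i> * complex_of_real (\<theta>\<^sub>2 p) \<and>
     z = - complex_of_real (d\<theta>\<^sub>1 p) + \<i> * complex_of_real (\<theta>\<^sub>1 p)"
  by (auto simp: \<theta>\<^sub>1_def \<theta>\<^sub>2_def d\<theta>\<^sub>1_def d\<theta>\<^sub>2_def prod_eq_iff complex_eq_iff)

definition \<eta>\<^sub>1 :: "complex \<times> complex \<Rightarrow> real" where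
  "\<eta>\<^sub>1 p = - \<theta>\<^sub>1 p / (2 * \<theta>\<^sub>2 p)"

definition \<eta>\<^sub>2 :: "complex \<times> complex \<Rightarrow> real" where
  "\<eta>\<^sub>2 p = ((\<theta>\<^sub>1 p)^2 - 2 * \<theta>\<^sub>2 p) / (4 * (\<theta>\<^sub>2 p)^2)"


section \<open>The Lie algebra of the Jacobi group and the momentum map\<close>

type_synonym jacobi_vector = "(real ^ 2 ^ 2) \<times> real \<times> real \<times> real"

definition jacobi_lie_algebra :: "jacobi_vector set" where
  "jacobi_lie_algebra = {(A, w). trace A = 0}"

definition basis_F :: jacobi_vector where "basis_F = (vector [vector [0, 1], vector [0, 0]], 0)"
definition basis_G :: jacobi_vector where "basis_G = (vector [vector [0, 0], vector [1, 0]], 0)"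
definition basis_H :: jacobi_vector where "basis_H = (vector [vector [1, 0], vector [0, -1]], 0)"
definition basis_P :: jacobi_vector where "basis_P = (0, 1, 0, 0)"
definition basis_Q :: jacobi_vector where "basis_Q = (0, 0, 1, 0)"
definition basis_R :: jacobi_vector where "basis_R = (0, 0, 0, 1)"

text \<open>
  An element \<open>(A, a, b, r)\<close> of the Lie algebra has coordinates
  \<open>A\<^sub>1\<^sub>2, A\<^sub>2\<^sub>1, A\<^sub>1\<^sub>1, a, b, r\<close> in the basis \<open>F, G, H, P, Q, R\<close>.
\<close>

definition momentum_map :: "complex \<times> complex \<Rightarrow> jacobi_vector \<Rightarrow> real" where
  "momentum_map p = (\<lambda>(A, a, b, r).
       A$1$2 * (- \<eta>\<^sub>2 p)
     + A$2$1 * ((d\<theta>\<^sub>1 p)^2 / 4 + \<eta>\<^sub>2 p * (d\<theta>\<^sub>2 p)^2 + \<eta>\<^sub>1 p * d\<theta>\<^sub>1 p * d\<theta>\<^sub>2 p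
                - 1 / (4 * ((\<eta>\<^sub>1 p)^2 - \<eta>\<^sub>2 p)))
     + A$1$1 * (- \<eta>\<^sub>1 p * d\<theta>\<^sub>1 p - 2 * \<eta>\<^sub>2 p * d\<theta>\<^sub>2 p)
     + a * (d\<theta>\<^sub>1 p / 2 + \<eta>\<^sub>1 p * d\<theta>\<^sub>2 p)
     + b * \<eta>\<^sub>1 p
     + r * (- 1 / 4))"

lemma jacobi_lie_algebra_expansion:
  assumes "(A, a, b, r) \<in> jacobi_lie_algebra"
  shows "(A, a, b, r) = A$1$2 *\<^sub>R basis_F + A$2$1 *\<^sub>R basis_G + A$1$1 *\<^sub>R basis_H
           + a *\<^sub>R basis_P + b *\<^sub>R basis_Q + r *\<^sub>R basis_R"
  using assms
  by (auto simp: jacobi_lie_algebra_def basis_F_def basis_G_def basis_H_def basis_P_def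
      basis_Q_def basis_R_def prod_eq_iff vec_eq_iff forall_2 vector_2 trace_def sum_2)

lemma linear_momentum_map: "linear (momentum_map p)"
  by (rule linearI) (auto simp: momentum_map_def algebra_simps add_divide_distrib)

lemma momentum_map_basis:
  "momentum_map p basis_F = - \<eta>\<^sub>2 p"
  "momentum_map p basis_G = (d\<theta>\<^sub>1 p)^2 / 4 + \<eta>\<^sub>2 p * (d\<theta>\<^sub>2 p)^2 + \<eta>\<^sub>1 p * d\<theta>\<^sub>1 p * d\<theta>\<^sub>2 p
     - 1 / (4 * ((\<eta>\<^sub>1 p)^2 - \<eta>\<^sub>2 p))"
  "momentum_map p basis_H = - \<eta>\<^sub>1 p * d\<theta>\<^sub>1 p - 2 * \<eta>\<^sub>2 p * d\<theta>\<^sub>2 p"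
  "momentum_map p basis_P = d\<theta>\<^sub>1 p / 2 + \<eta>\<^sub>1 p * d\<theta>\<^sub>2 p"
  "momentum_map p basis_Q = \<eta>\<^sub>1 p"
  "momentum_map p basis_R = - 1 / 4"
  by (simp_all add: momentum_map_def basis_F_def basis_G_def basis_H_def basis_P_def
      basis_Q_def basis_R_def vector_2 zero_prod_def)

end

theory Submission
  imports Defs
begin

text \<open>
  On pairs of constant vector fields, four of the equations \<open>L\<^sub>X g = 0\<close> for \<open>X = X\<^sub>f\<close> express
  \<open>\<partial>\<^sub>u f\<close>, \<open>\<partial>\<^sub>v f\<close> and all their \<open>(x, y)\<close>-derivatives through fibre derivatives of \<open>f\<close>, and give
  \<open>f\<^sub>y\<^sub>y\<^sub>y = 3 f\<^sub>x\<^sub>x\<^sub>y\<close> and \<open>f\<^sub>x\<^sub>x\<^sub>x = 3 f\<^sub>x\<^sub>y\<^sub>y\<close>. Differentiating further and comparing shows that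
  all fibre derivatives of order three vanish. The remaining first-order system then determines \<open>f\<close>
  up to six constants, the coordinates of \<open>L\<close>. Conversely, the Hamiltonian vector field of such
  an \<open>f\<close> is polynomial, namely \<open>(-2c + 4b\<tau> - 2a\<tau>\<^sup>2, 2(bz - a\<tau>z + k - e\<tau>))\<close>, and is checked to be
  Killing.
\<close>

section \<open>Directional derivatives of smooth functions\<close>

text \<open>The direction comes first so that \<open>dir_deriv w\<close> is an operator on functions
  that can be nested and iterated with \<open>^^\<close>.\<close>

definition dir_deriv :: "'a::real_normed_vector \<Rightarrow> ('a \<Rightarrow> 'b::real_normed_vector) \<Rightarrow> 'a \<Rightarrow> 'b" where
  "dir_deriv w f p = frechet_derivative f (at p) w"

lemma smooth_on_dir_deriv:
  assumes "smooth_on S f"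
  shows "smooth_on S (dir_deriv w f)"
  unfolding smooth_on_def
proof
  fix n
  have "higher_differentiable_on S f (Suc n)"
    using assms by (simp only: smooth_on_def)
  then show "higher_differentiable_on S (dir_deriv w f) n"
    by (simp add: dir_deriv_def[abs_def])
qed

lemma smooth_on_differentiable:
  assumes "smooth_on S f" "p \<in> S"
  shows "f differentiable (at p)"
  using assms(1)[unfolded smooth_on_def, rule_format, of 1] assms(2) by simp

lemma smooth_on_continuous: "smooth_on S f \<Longrightarrow> continuous_on S f"
  by (metis smooth_on_def higher_differentiable_on.simps(1))

lemma smooth_on_const: "smooth_on S (\<lambda>_. c)"
proof -
  have "higher_differentiable_on S (\<lambda>_. c) n" for n
    by (induction n arbitrary: c) simp_all
  then show ?thesis by (simp add: smooth_on_def)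
qed

text \<open>Chain rule along an affine line, the bridge to one-variable calculus. Differentiability
  is required only at the point reached at time \<open>t\<close>.\<close>

lemma has_real_derivative_dir_deriv:
  fixes f :: "'a::real_normed_vector \<Rightarrow> real"
  assumes "f differentiable (at (p + t *\<^sub>R w))"
  shows "((\<lambda>t. f (p + t *\<^sub>R w)) has_real_derivative dir_deriv w f (p + t *\<^sub>R w)) (at t)"
proof -
  have f: "(f has_derivative frechet_derivative f (at (p + t *\<^sub>R w))) (at (p + t *\<^sub>R w))"
    using assms frechet_derivative_works by blast
  have "((\<lambda>t. p + t *\<^sub>R w) has_derivative (\<lambda>h. h *\<^sub>R w)) (at t)"
    by (auto intro!: derivative_eq_intros)
  from has_derivative_compose[OF this f]
  have "((\<lambda>t. f (p + t *\<^sub>R w)) has_derivative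
      (\<lambda>h. frechet_derivative f (at (p + t *\<^sub>R w)) (h *\<^sub>R w))) (at t)" .
  then show ?thesis
    using linear_scale[OF linear_frechet_derivative[OF assms]]
    by (simp add: has_field_derivative_def dir_deriv_def mult.commute[of _ "frechet_derivative _ _ _"])
qed

lemma dir_deriv_cong:
  assumes "open S" "p \<in> S" "f differentiable (at p)" "\<And>q. q \<in> S \<Longrightarrow> f q = g q"
  shows "dir_deriv w f p = dir_deriv w g p"
  unfolding dir_deriv_def using frechet_derivative_transform_within_open[OF assms(3,1,2,4)] by simp

section \<open>Symmetry of second directional derivatives\<close>

text \<open>The mean value theorem is applied twice: along \<open>w\<close> to the increment of
  \<open>f\<close> across \<open>h *\<^sub>R w'\<close>, then along \<open>w'\<close> to
  \<open>dir_deriv w f\<close>. The second difference itself is symmetric in \<open>w\<close> and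
  \<open>w'\<close>.\<close>

lemma second_difference_mvt:
  fixes f :: "'a::real_normed_vector \<Rightarrow> real"
  assumes h: "h > 0"
    and S: "\<And>s t. 0 \<le> s \<Longrightarrow> s \<le> h \<Longrightarrow> 0 \<le> t \<Longrightarrow> t \<le> h \<Longrightarrow> p + s *\<^sub>R w + t *\<^sub>R w' \<in> S"
    and f: "\<And>q. q \<in> S \<Longrightarrow> f differentiable (at q)"
    and df: "\<And>q. q \<in> S \<Longrightarrow> dir_deriv w f differentiable (at q)"
  obtains s t where "0 < s" "s < h" "0 < t" "t < h"
    "f (p + h *\<^sub>R w + h *\<^sub>R w') - f (p + h *\<^sub>R w) - f (p + h *\<^sub>R w') + f p =
       h\<^sup>2 * dir_deriv w' (dir_deriv w f) (p + s *\<^sub>R w + t *\<^sub>R w')"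
proof -
  let ?\<phi> = "\<lambda>s. f (p + h *\<^sub>R w' + s *\<^sub>R w) - f (p + s *\<^sub>R w)"
  have "\<exists>s>0. s < h \<and> ?\<phi> h - ?\<phi> 0 =
      (h - 0) * (dir_deriv w f (p + h *\<^sub>R w' + s *\<^sub>R w) - dir_deriv w f (p + s *\<^sub>R w))"
  proof (rule MVT2[OF h])
    fix s assume "0 \<le> s" "s \<le> h"
    then have "p + h *\<^sub>R w' + s *\<^sub>R w \<in> S" "p + s *\<^sub>R w \<in> S"
      using S[of s h] S[of s 0] h by (simp_all add: algebra_simps)
    then show "(?\<phi> has_real_derivative
        (dir_deriv w f (p + h *\<^sub>R w' + s *\<^sub>R w) - dir_deriv w f (p + s *\<^sub>R w))) (at s)"
      by (intro DERIV_diff has_real_derivative_dir_deriv f)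
  qed
  then obtain s where s: "0 < s" "s < h" and 1: "?\<phi> h - ?\<phi> 0 =
      h * (dir_deriv w f (p + s *\<^sub>R w + h *\<^sub>R w') - dir_deriv w f (p + s *\<^sub>R w))"
    by (auto simp: algebra_simps)
  let ?\<psi> = "\<lambda>t. dir_deriv w f (p + s *\<^sub>R w + t *\<^sub>R w')"
  have "\<exists>t>0. t < h \<and> ?\<psi> h - ?\<psi> 0 =
      (h - 0) * dir_deriv w' (dir_deriv w f) (p + s *\<^sub>R w + t *\<^sub>R w')"
    by (rule MVT2[OF h]) (use s S in \<open>auto intro!: has_real_derivative_dir_deriv df\<close>)
  then obtain t where t: "0 < t" "t < h" and 2: "?\<psi> h - ?\<psi> 0 =
      h * dir_deriv w' (dir_deriv w f) (p + s *\<^sub>R w + t *\<^sub>R w')"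
    by auto
  show thesis
  proof (rule that[OF s t])
    show "f (p + h *\<^sub>R w + h *\<^sub>R w') - f (p + h *\<^sub>R w) - f (p + h *\<^sub>R w') + f p =
       h\<^sup>2 * dir_deriv w' (dir_deriv w f) (p + s *\<^sub>R w + t *\<^sub>R w')"
      using 1 2 by (simp add: power2_eq_square add.commute add.left_commute)
  qed
qed

text \<open>Schwarz's theorem: by symmetry the same second difference is \<open>h\<^sup>2\<close>
  times either mixed derivative, taken at points near \<open>p\<close>; continuity of both then
  excludes different values at \<open>p\<close>.\<close>

lemma dir_deriv_commute:
  fixes f :: "'a::real_normed_vector \<Rightarrow> real"
  assumes S: "open S" "p \<in> S" and f: "smooth_on S f"
  shows "dir_deriv w' (dir_deriv w f) p = dir_deriv w (dir_deriv w' f) p"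
proof (rule ccontr)
  let ?A = "dir_deriv w' (dir_deriv w f)" and ?B = "dir_deriv w (dir_deriv w' f)"
  assume ne: "?A p \<noteq> ?B p"
  \<comment> \<open>Half the gap: values closer than \<open>e\<close> to \<open>?A p\<close> and to
    \<open>?B p\<close> cannot coincide.\<close>
  define e where "e = \<bar>?A p - ?B p\<bar> / 2"
  have e: "e > 0" using ne by (simp add: e_def)
  have "isCont ?A p" "isCont ?B p"
    using S f by (auto intro!: smooth_on_dir_deriv smooth_on_continuous
        simp: continuous_on_eq_continuous_at[symmetric]
        dest!: continuous_on_eq_continuous_at)
  then have "\<forall>\<^sub>F q in nhds p. \<bar>?A q - ?A p\<bar> < e \<and> \<bar>?B q - ?B p\<bar> < e \<and> q \<in> S"
    using e S unfolding continuous_at_imp_continuous_within isCont_def tendsto_iff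
    by (auto simp: eventually_conj_iff eventually_at_filter dist_real_def eventually_nhds_in_open
        elim!: eventually_mono)
  then obtain d where d: "d > 0"
    and near: "\<And>q. dist q p < d \<Longrightarrow> \<bar>?A q - ?A p\<bar> < e \<and> \<bar>?B q - ?B p\<bar> < e \<and> q \<in> S"
    unfolding eventually_nhds_metric by blast
  \<comment> \<open>The summand 1 keeps the denominator positive when both directions are zero; the
    factor 1/2 makes \<open>hd\<close> strict.\<close>
  define h where "h = d / (norm w + norm w' + 1) / 2"
  have h: "h > 0" using d unfolding h_def
    by (intro divide_pos_pos) (auto intro: add_nonneg_pos)
  have hd: "h * (norm w + norm w') < d"
  proof -
    have "h * (norm w + norm w') \<le> h * (norm w + norm w' + 1)" using h by simp
    also have "\<dots> = d / 2"
      unfolding h_def using norm_ge_zero[of w] norm_ge_zero[of w'] by (simp add: field_simps add_nonneg_eq_0_iff)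
    finally show ?thesis using d by simp
  qed
  have inball: "dist (p + s *\<^sub>R w + t *\<^sub>R w') p < d"
    if "0 \<le> s" "s \<le> h" "0 \<le> t" "t \<le> h" for s t
  proof -
    have "dist (p + s *\<^sub>R w + t *\<^sub>R w') p = norm (s *\<^sub>R w + t *\<^sub>R w')"
      by (simp add: dist_norm)
    also have "\<dots> \<le> s * norm w + t * norm w'"
      using norm_triangle_ineq[of "s *\<^sub>R w" "t *\<^sub>R w'"] that by simp
    also have "\<dots> \<le> h * norm w + h * norm w'"
      using that by (intro add_mono mult_right_mono) auto
    finally show ?thesis using hd by (simp add: algebra_simps)
  qed
  have inball': "dist (p + s *\<^sub>R w' + t *\<^sub>R w) p < d"
    if "0 \<le> s" "s \<le> h" "0 \<le> t" "t \<le> h" for s t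
    using inball[of t s] that by (simp add: algebra_simps)
  note diff = smooth_on_differentiable[OF f] smooth_on_differentiable[OF smooth_on_dir_deriv[OF f]]
  obtain s t where st: "0 < s" "s < h" "0 < t" "t < h" and
    1: "f (p + h *\<^sub>R w + h *\<^sub>R w') - f (p + h *\<^sub>R w) - f (p + h *\<^sub>R w') + f p =
       h\<^sup>2 * ?A (p + s *\<^sub>R w + t *\<^sub>R w')"
    using near inball by (rule_tac second_difference_mvt[OF h _ diff, where p=p and w=w and w'=w']) auto
  obtain s' t' where st': "0 < s'" "s' < h" "0 < t'" "t' < h" and
    2: "f (p + h *\<^sub>R w' + h *\<^sub>R w) - f (p + h *\<^sub>R w') - f (p + h *\<^sub>R w) + f p =
       h\<^sup>2 * ?B (p + s' *\<^sub>R w' + t' *\<^sub>R w)"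
    using near inball' by (rule_tac second_difference_mvt[OF h _ diff, where p=p and w=w' and w'=w]) auto
  have "h\<^sup>2 * ?A (p + s *\<^sub>R w + t *\<^sub>R w') = h\<^sup>2 * ?B (p + s' *\<^sub>R w' + t' *\<^sub>R w)"
    using 1 2 by (simp add: algebra_simps)
  then have "?A (p + s *\<^sub>R w + t *\<^sub>R w') = ?B (p + s' *\<^sub>R w' + t' *\<^sub>R w)"
    using h by simp
  moreover have "\<bar>?A (p + s *\<^sub>R w + t *\<^sub>R w') - ?A p\<bar> < e"
    using near[OF inball[of s t]] st by simp
  moreover have "\<bar>?B (p + s' *\<^sub>R w' + t' *\<^sub>R w) - ?B p\<bar> < e"
    using near[OF inball'[of s' t']] st' by simp
  ultimately have "\<bar>?A p - ?B p\<bar> < 2 * e" by linarith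
  then show False by (simp add: e_def)
qed

section \<open>The overdetermined system on a fibre\<close>

text \<open>Every point is joined to \<open>(0, 1, 0, 0)\<close> by segments parallel to the axes,
  along each of which only one variable moves.\<close>

lemma zero_partials_imp_constant:
  fixes G :: "real \<Rightarrow> real \<Rightarrow> real \<Rightarrow> real \<Rightarrow> real"
  assumes "\<And>u v x y. v > 0 \<Longrightarrow> ((\<lambda>u. G u v x y) has_real_derivative 0) (at u)"
    and "\<And>u v x y. v > 0 \<Longrightarrow> ((\<lambda>v. G u v x y) has_real_derivative 0) (at v)"
    and "\<And>u v x y. v > 0 \<Longrightarrow> ((\<lambda>x. G u v x y) has_real_derivative 0) (at x)"
    and "\<And>u v x y. v > 0 \<Longrightarrow> ((\<lambda>y. G u v x y) has_real_derivative 0) (at y)"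
  obtains C where "\<And>u v x y. v > 0 \<Longrightarrow> G u v x y = C"
proof
  fix u v x y :: real assume v: "v > 0"
  have "G u v x y = G 0 v x y"
    by (rule DERIV_isconst_all) (use assms(1) v in auto)
  also have "\<dots> = G 0 v 0 y"
    by (rule DERIV_isconst_all) (use assms(3) v in auto)
  also have "\<dots> = G 0 v 0 0"
    by (rule DERIV_isconst_all) (use assms(4) v in auto)
  \<comment> \<open>The variable v runs over a half-line only, so this leg uses the convex set
    \<open>{0<..}\<close> instead of the whole real line.\<close>
  also have "\<exists>c. \<forall>v\<in>{0<..}. G 0 v 0 0 = c"
    by (rule has_field_derivative_zero_constant)
      (use assms(2) in \<open>auto intro: has_field_derivative_at_within\<close>)
  then have "G 0 v 0 0 = G 0 1 0 0" using v by force
  finally show "G u v x y = G 0 1 0 0" .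
qed

text \<open>\<open>F c d\<close> stands for \<open>\<partial>\<^sub>x\<^sup>c \<partial>\<^sub>y\<^sup>d f\<close>. The \<open>u\<close>- and \<open>v\<close>-derivatives are the derivatives \<open>\<partial>\<^sub>x\<^sup>c \<partial>\<^sub>y\<^sup>d\<close> of
  the \<open>(x, x)\<close> and \<open>(x, y)\<close> components of the Killing equation; for \<open>d = 0\<close> the coefficient of
  \<open>F (Suc c) (d - 1)\<close> vanishes.\<close>

locale killing_jet =
  fixes F :: "nat \<Rightarrow> nat \<Rightarrow> real \<Rightarrow> real \<Rightarrow> real \<Rightarrow> real \<Rightarrow> real"
  assumes deriv_x: "v > 0 \<Longrightarrow> ((\<lambda>x. F c d u v x y) has_real_derivative F (Suc c) d u v x y) (at x)"
    and deriv_y: "v > 0 \<Longrightarrow> ((\<lambda>y. F c d u v x y) has_real_derivative F c (Suc d) u v x y) (at y)"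
    and deriv_u: "v > 0 \<Longrightarrow> ((\<lambda>u. F c d u v x y) has_real_derivative
      - 2 * F (Suc c) (Suc d) u v x y - y / v * F (Suc c) d u v x y
      - real d / v * F (Suc c) (d - 1) u v x y) (at u)"
    and deriv_v: "v > 0 \<Longrightarrow> ((\<lambda>v. F c d u v x y) has_real_derivative
      F (Suc (Suc c)) d u v x y - F c (Suc (Suc d)) u v x y
      - y / v * F c (Suc d) u v x y - real d / v * F c d u v x y) (at v)"
    and cubic_y: "v > 0 \<Longrightarrow> F 0 3 u v x y = 3 * F 2 1 u v x y"
    and cubic_x: "v > 0 \<Longrightarrow> F 3 0 u v x y = 3 * F 1 2 u v x y"
begin

section \<open>Differentiating linear relations between fibre derivatives\<close>

text \<open>Fibre lines stay in the domain \<open>v > 0\<close>, so a relation valid there may be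
  differentiated as an equality of functions on the whole line. The case \<open>k = 0\<close>
  propagates vanishing to higher orders.\<close>

lemma multiple_x:
  assumes "\<And>u v x y. v > 0 \<Longrightarrow> F c d u v x y = k * F c' d' u v x y" "v > 0"
  shows "F (Suc c) d u v x y = k * F (Suc c') d' u v x y"
proof -
  have "(\<lambda>x. F c d u v x y) = (\<lambda>x. k * F c' d' u v x y)"
    using assms by auto
  moreover have "((\<lambda>x. k * F c' d' u v x y) has_real_derivative k * F (Suc c') d' u v x y) (at x)"
    by (intro DERIV_cmult deriv_x assms)
  ultimately show ?thesis using deriv_x[OF assms(2), of c d u y x] DERIV_unique by metis
qed

lemma multiple_y:
  assumes "\<And>u v x y. v > 0 \<Longrightarrow> F c d u v x y = k * F c' d' u v x y" "v > 0"
  shows "F c (Suc d) u v x y = k * F c' (Suc d') u v x y"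
proof -
  have "(\<lambda>y. F c d u v x y) = (\<lambda>y. k * F c' d' u v x y)"
    using assms by auto
  moreover have "((\<lambda>y. k * F c' d' u v x y) has_real_derivative k * F c' (Suc d') u v x y) (at y)"
    by (intro DERIV_cmult deriv_y assms)
  ultimately show ?thesis using deriv_y[OF assms(2), of c d u x y] DERIV_unique by metis
qed

lemmas zero_x = multiple_x[where k = 0, simplified]
lemmas zero_y = multiple_y[where k = 0, simplified]

text \<open>Both sides are differentiated by \<open>deriv_v\<close>. When \<open>d\<close> and
  \<open>d'\<close> differ, so do the weight terms \<open>real d / v\<close> and
  \<open>real d' / v\<close>; this mismatch is what forces vanishing below.\<close>

lemma deriv_v_multiple:
  assumes "\<And>u v x y. v > 0 \<Longrightarrow> F c d u v x y = k * F c' d' u v x y" and v: "v > 0"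
  shows "F (Suc (Suc c)) d u v x y - F c (Suc (Suc d)) u v x y
      - y / v * F c (Suc d) u v x y - real d / v * F c d u v x y
    = k * (F (Suc (Suc c')) d' u v x y - F c' (Suc (Suc d')) u v x y
      - y / v * F c' (Suc d') u v x y - real d' / v * F c' d' u v x y)" (is "?L = k * ?R")
proof -
  have "((\<lambda>v. k * F c' d' u v x y) has_real_derivative k * ?R) (at v)"
    by (intro DERIV_cmult deriv_v v)
  \<comment> \<open>The relation is known for positive v only, hence the comparison within an open
    half-line.\<close>
  moreover have "((\<lambda>v. k * F c' d' u v x y) has_real_derivative ?L) (at v)"
    by (rule has_field_derivative_transform_within_open[OF deriv_v[OF v], of "{0<..}"])
      (use assms in auto)
  ultimately show ?thesis using DERIV_unique by blast
qed

lemma deriv_u_zero: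
  assumes "\<And>u v x y. v > 0 \<Longrightarrow> F c d u v x y = 0" and v: "v > 0"
  shows "- 2 * F (Suc c) (Suc d) u v x y - y / v * F (Suc c) d u v x y
      - real d / v * F (Suc c) (d - 1) u v x y = 0"
proof -
  have "(\<lambda>u. F c d u v x y) = (\<lambda>_. 0)" using assms by auto
  then show ?thesis using deriv_u[OF v, of c d x y u] DERIV_unique[OF _ DERIV_const]
    by metis
qed

section \<open>Vanishing of the fibre derivatives of order three\<close>

text \<open>Differentiating \<open>cubic_y\<close> in x and \<open>cubic_x\<close> in y makes each
  of the two mixed derivatives three times the other.\<close>

lemma fourth_mixed_zero:
  assumes "v > 0"
  shows "F 3 1 u v x y = 0" "F 1 3 u v x y = 0"
proof -
  have "F 1 3 u v x y = 3 * F 3 1 u v x y"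
    using multiple_x[OF cubic_y assms] by (simp add: eval_nat_numeral)
  moreover have "F 3 1 u v x y = 3 * F 1 3 u v x y"
    using multiple_y[OF cubic_x assms] by (simp add: eval_nat_numeral)
  ultimately show "F 3 1 u v x y = 0" "F 1 3 u v x y = 0" by auto
qed

lemma fourth_pure:
  assumes "v > 0"
  shows "F 4 0 u v x y = 3 * F 2 2 u v x y" "F 0 4 u v x y = 3 * F 2 2 u v x y"
  using multiple_x[OF cubic_x assms] multiple_y[OF cubic_y assms]
  by (simp_all add: eval_nat_numeral)

lemma fifth_zero:
  assumes "v > 0"
  shows "F 5 0 u v x y = 0" "F 4 1 u v x y = 0" "F 3 2 u v x y = 0"
    "F 2 3 u v x y = 0" "F 1 4 u v x y = 0" "F 0 5 u v x y = 0"
proof -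
  show 32: "F 3 2 u v x y = 0" using zero_y[OF fourth_mixed_zero(1) assms] by (simp add: eval_nat_numeral)
  show 41: "F 4 1 u v x y = 0" using zero_x[OF fourth_mixed_zero(1) assms] by (simp add: eval_nat_numeral)
  show 23: "F 2 3 u v x y = 0" using zero_x[OF fourth_mixed_zero(2) assms] by (simp add: eval_nat_numeral)
  show 14: "F 1 4 u v x y = 0" using zero_y[OF fourth_mixed_zero(2) assms] by (simp add: eval_nat_numeral)
  show "F 5 0 u v x y = 0" using multiple_x[OF fourth_pure(1) assms] 32 by (simp add: eval_nat_numeral)
  show "F 0 5 u v x y = 0" using multiple_y[OF fourth_pure(2) assms] 23 by (simp add: eval_nat_numeral)
qed

lemma sixth_zero:
  assumes "v > 0"
  shows "F 6 0 u v x y = 0" "F 4 2 u v x y = 0" "F 2 4 u v x y = 0" "F 0 6 u v x y = 0"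
  using zero_x[OF fifth_zero(1) assms] zero_y[OF fifth_zero(2) assms] zero_y[OF fifth_zero(4) assms]
    zero_y[OF fifth_zero(6) assms]
  by (simp_all add: eval_nat_numeral)

text \<open>\<open>F 4 0 = F 0 4\<close>, but only the \<open>v\<close>-derivative of \<open>F 0 4\<close> contains a term \<open>- 4 / v * F 0 4\<close>.\<close>

lemma F22_zero:
  assumes "v > 0"
  shows "F 2 2 u v x y = 0"
proof -
  have "F 4 0 u v x y = 1 * F 0 4 u v x y" if "v > 0" for u v x y
    using fourth_pure[OF that] by simp
  from deriv_v_multiple[OF this assms]
  have "F 0 4 u v x y = 0"
    using assms sixth_zero[OF assms] fifth_zero[OF assms]
    by (auto simp: eval_nat_numeral)
  then show ?thesis using fourth_pure[OF assms] by simp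
qed

lemma fourth_zero:
  assumes "v > 0"
  shows "F 4 0 u v x y = 0" "F 3 1 u v x y = 0" "F 2 2 u v x y = 0" "F 1 3 u v x y = 0"
    "F 0 4 u v x y = 0"
  using fourth_mixed_zero[OF assms] fourth_pure[OF assms] F22_zero[OF assms] by simp_all

text \<open>In the v-derivative of \<open>cubic_x\<close> every term of order four or five vanishes;
  the right side keeps a multiple of \<open>F 1 2 / v\<close>, while the weight of
  \<open>F 3 0\<close> is zero.\<close>

lemma F12_zero:
  assumes "v > 0"
  shows "F 1 2 u v x y = 0"
  using deriv_v_multiple[OF cubic_x assms, of u x y] fourth_zero[OF assms] fifth_zero[OF assms] assms
  by (auto simp: eval_nat_numeral)

text \<open>The u-derivative of \<open>F 1 2\<close> contains \<open>- 2 / v * F 2 1\<close> besides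
  terms of higher order, which vanish.\<close>

lemma F21_zero:
  assumes "v > 0"
  shows "F 2 1 u v x y = 0"
  using deriv_u_zero[OF F12_zero assms, of u x y] fourth_zero[OF assms] fifth_zero[OF assms] assms
  by (auto simp: eval_nat_numeral)

lemma third_zero:
  assumes "v > 0"
  shows "F 3 0 u v x y = 0" "F 2 1 u v x y = 0" "F 1 2 u v x y = 0" "F 0 3 u v x y = 0"
  using F12_zero[OF assms] F21_zero[OF assms] cubic_x[OF assms] cubic_y[OF assms] by simp_all

text \<open>Successor form of the indices, matching the terms that the derivative rules of the
  locale produce.\<close>

lemma zero_simps:
  assumes "v > 0"
  shows "F (Suc (Suc (Suc 0))) 0 u v x y = 0" "F (Suc (Suc 0)) (Suc 0) u v x y = 0"
    "F (Suc 0) (Suc (Suc 0)) u v x y = 0" "F 0 (Suc (Suc (Suc 0))) u v x y = 0"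
    "F (Suc (Suc (Suc (Suc 0)))) 0 u v x y = 0" "F (Suc (Suc (Suc 0))) (Suc 0) u v x y = 0"
    "F (Suc (Suc 0)) (Suc (Suc 0)) u v x y = 0" "F (Suc 0) (Suc (Suc (Suc 0))) u v x y = 0"
    "F 0 (Suc (Suc (Suc (Suc 0)))) u v x y = 0"
  using third_zero[OF assms] fourth_zero[OF assms] by (simp_all add: eval_nat_numeral)

section \<open>Integration of the remaining first-order system\<close>

text \<open>With order three gone, \<open>deriv_v\<close> reduces to the weight term
  \<open>- real d / v\<close>, so multiplication by \<open>v ^ d\<close> removes the dependence on
  v. A polynomial in u then compensates the u-derivative, and the constants \<open>a\<close>,
  \<open>b\<close>, \<open>c\<close> appear one after the other.\<close>

lemma second_derivatives:
  obtains a b c where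
    "\<And>u v x y. v > 0 \<Longrightarrow> F (Suc (Suc 0)) 0 u v x y = a"
    "\<And>u v x y. v > 0 \<Longrightarrow> F (Suc 0) (Suc 0) u v x y = (b - a * u) / v"
    "\<And>u v x y. v > 0 \<Longrightarrow> F 0 (Suc (Suc 0)) u v x y = (c - 2 * b * u + a * u\<^sup>2) / v\<^sup>2"
proof -
  note [derivative_intros] = deriv_u deriv_v deriv_x deriv_y
  obtain a where a: "\<And>u v x y. v > 0 \<Longrightarrow> F (Suc (Suc 0)) 0 u v x y = a"
    by (rule zero_partials_imp_constant[of "F (Suc (Suc 0)) 0"])
      (auto intro!: derivative_eq_intros simp: zero_simps)
  obtain b where b: "\<And>u v x y. v > 0 \<Longrightarrow> v * F (Suc 0) (Suc 0) u v x y + a * u = b"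
    by (rule zero_partials_imp_constant[of "\<lambda>u v x y. v * F (Suc 0) (Suc 0) u v x y + a * u"])
      (auto intro!: derivative_eq_intros simp: zero_simps a)
  have b': "F (Suc 0) (Suc 0) u v x y = (b - a * u) / v" if "v > 0" for u v x y
    using b[OF that, of u x y] that by (simp add: field_simps)
  obtain c where c: "\<And>u v x y. v > 0 \<Longrightarrow> v\<^sup>2 * F 0 (Suc (Suc 0)) u v x y + 2 * b * u - a * u\<^sup>2 = c"
    by (rule zero_partials_imp_constant[of
          "\<lambda>u v x y. v\<^sup>2 * F 0 (Suc (Suc 0)) u v x y + 2 * b * u - a * u\<^sup>2"])
      (auto intro!: derivative_eq_intros simp: zero_simps b' field_simps power2_eq_square)
  have c': "F 0 (Suc (Suc 0)) u v x y = (c - 2 * b * u + a * u\<^sup>2) / v\<^sup>2" if "v > 0" for u v x y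
    using c[OF that, of u x y] that by (simp add: field_simps)
  show thesis using that[OF a b' c'] .
qed

text \<open>The combinations \<open>q = x - u * y / v\<close> and \<open>s = y / v\<close> are the
  real coordinates with z = q + s \<tau>. The formulas are the x- and y-derivatives of \<open>a *
  q\<^sup>2 / 2 + b * q * s + c * s\<^sup>2 / 2 + e * q + k * s\<close>.\<close>

lemma first_derivatives:
  obtains a b c e k where
    "\<And>u v x y. v > 0 \<Longrightarrow> F (Suc (Suc 0)) 0 u v x y = a"
    "\<And>u v x y. v > 0 \<Longrightarrow> F (Suc 0) (Suc 0) u v x y = (b - a * u) / v"
    "\<And>u v x y. v > 0 \<Longrightarrow> F 0 (Suc (Suc 0)) u v x y = (c - 2 * b * u + a * u\<^sup>2) / v\<^sup>2"
    "\<And>u v x y. v > 0 \<Longrightarrow> F (Suc 0) 0 u v x y = a * (x - u * y / v) + b * y / v + e"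
    "\<And>u v x y. v > 0 \<Longrightarrow> F 0 (Suc 0) u v x y =
      (b * (x - u * y / v) + c * y / v + k - u * (a * (x - u * y / v) + b * y / v + e)) / v"
proof -
  note [derivative_intros] = deriv_u deriv_v deriv_x deriv_y
  obtain a b c where
    a: "\<And>u v x y. v > 0 \<Longrightarrow> F (Suc (Suc 0)) 0 u v x y = a" and
    b: "\<And>u v x y. v > 0 \<Longrightarrow> F (Suc 0) (Suc 0) u v x y = (b - a * u) / v" and
    c: "\<And>u v x y. v > 0 \<Longrightarrow> F 0 (Suc (Suc 0)) u v x y = (c - 2 * b * u + a * u\<^sup>2) / v\<^sup>2"
    using second_derivatives by blast
  obtain e where e: "\<And>u v x y. v > 0 \<Longrightarrow>
      F (Suc 0) 0 u v x y - (a * (x - u * y / v) + b * y / v) = e"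
    by (rule zero_partials_imp_constant[of
          "\<lambda>u v x y. F (Suc 0) 0 u v x y - (a * (x - u * y / v) + b * y / v)"])
      (auto intro!: derivative_eq_intros simp: zero_simps a b c field_simps power2_eq_square)
  have e': "F (Suc 0) 0 u v x y = a * (x - u * y / v) + b * y / v + e" if "v > 0" for u v x y
    using e[OF that, of u x y] by simp
  obtain k where k: "\<And>u v x y. v > 0 \<Longrightarrow>
      v * F 0 (Suc 0) u v x y + u * (a * (x - u * y / v) + b * y / v + e)
      - (b * (x - u * y / v) + c * y / v) = k"
    by (rule zero_partials_imp_constant[of
          "\<lambda>u v x y. v * F 0 (Suc 0) u v x y + u * (a * (x - u * y / v) + b * y / v + e)
      - (b * (x - u * y / v) + c * y / v)"])
      (auto intro!: derivative_eq_intros simp: zero_simps a b c e' field_simps power2_eq_square)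
  have k': "F 0 (Suc 0) u v x y =
      (b * (x - u * y / v) + c * y / v + k - u * (a * (x - u * y / v) + b * y / v + e)) / v"
    if "v > 0" for u v x y
    using k[OF that, of u x y] that by (simp add: field_simps)
  show thesis using that[OF a b c e' k'] .
qed

text \<open>The terms without x and y, namely (a |\<tau>|^2 - 2 b Re \<tau> + c) / v, are forced by
  the second-order terms in \<open>deriv_u\<close> and \<open>deriv_v\<close>; \<open>m\<close> is
  the last constant of integration.\<close>

lemma solution:
  obtains a b c e k m where
    "\<And>u v x y. v > 0 \<Longrightarrow> F 0 0 u v x y =
      a * (x - u * y / v)\<^sup>2 / 2 + b * (x - u * y / v) * (y / v) + c * (y / v)\<^sup>2 / 2
      + e * (x - u * y / v) + k * (y / v) + a * (u\<^sup>2 + v\<^sup>2) / v - 2 * b * u / v + c / v + m"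
proof -
  note [derivative_intros] = deriv_u deriv_v deriv_x deriv_y
  obtain a b c e k where 1:
    "\<And>u v x y. v > 0 \<Longrightarrow> F (Suc (Suc 0)) 0 u v x y = a"
    "\<And>u v x y. v > 0 \<Longrightarrow> F (Suc 0) (Suc 0) u v x y = (b - a * u) / v"
    "\<And>u v x y. v > 0 \<Longrightarrow> F 0 (Suc (Suc 0)) u v x y = (c - 2 * b * u + a * u\<^sup>2) / v\<^sup>2"
    "\<And>u v x y. v > 0 \<Longrightarrow> F (Suc 0) 0 u v x y = a * (x - u * y / v) + b * y / v + e"
    "\<And>u v x y. v > 0 \<Longrightarrow> F 0 (Suc 0) u v x y =
      (b * (x - u * y / v) + c * y / v + k - u * (a * (x - u * y / v) + b * y / v + e)) / v"
    using first_derivatives by blast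
  obtain m where "\<And>u v x y. v > 0 \<Longrightarrow> F 0 0 u v x y -
      (a * (x - u * y / v)\<^sup>2 / 2 + b * (x - u * y / v) * (y / v) + c * (y / v)\<^sup>2 / 2
      + e * (x - u * y / v) + k * (y / v) + a * (u\<^sup>2 + v\<^sup>2) / v - 2 * b * u / v + c / v) = m"
    by (rule zero_partials_imp_constant[of "\<lambda>u v x y. F 0 0 u v x y -
      (a * (x - u * y / v)\<^sup>2 / 2 + b * (x - u * y / v) * (y / v) + c * (y / v)\<^sup>2 / 2
      + e * (x - u * y / v) + k * (y / v) + a * (u\<^sup>2 + v\<^sup>2) / v - 2 * b * u / v + c / v)"])
      (auto intro!: derivative_eq_intros simp: 1 field_simps power2_eq_square)
  then show thesis
    using that[of a b c e k m] by (simp add: algebra_simps)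
qed

end

section \<open>The Lie derivative along a Hamiltonian vector field\<close>

lemma open_siegel_jacobi_space: "open siegel_jacobi_space"
proof -
  have "siegel_jacobi_space = {p. 0 < Im (fst p)}"
    by (auto simp: siegel_jacobi_space_def)
  moreover have "open {p :: complex \<times> complex. 0 < Im (fst p)}"
    by (intro open_Collect_less continuous_intros)
  ultimately show ?thesis by simp
qed

lemma siegel_jacobi_space_iff: "p \<in> siegel_jacobi_space \<longleftrightarrow> Im (fst p) > 0"
  by (cases p) (simp add: siegel_jacobi_space_def)

text \<open>Product rule: the long bracket differentiates the metric coefficients, the last two
  summands differentiate the vector fields.\<close>

lemma has_derivative_g_KB:
  assumes p: "p \<in> siegel_jacobi_space"
    and Y: "(Y has_derivative Y') (at p)" and Z: "(Z has_derivative Z') (at p)"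
  defines "v \<equiv> Im (fst p)" and "y \<equiv> Im (snd p)"
  shows "((\<lambda>q. g_KB q (Y q) (Z q)) has_derivative (\<lambda>h.
    (((Im (fst h) + 2 * y * Im (snd h)) / v^3 - 3 * (v + y\<^sup>2) * Im (fst h) / v^4)
        * (Re (fst (Y p)) * Re (fst (Z p)) + Im (fst (Y p)) * Im (fst (Z p)))
     - (Im (snd h) / v\<^sup>2 - 2 * y * Im (fst h) / v^3)
        * (Re (fst (Y p)) * Re (snd (Z p)) + Im (fst (Y p)) * Im (snd (Z p))
           + Re (snd (Y p)) * Re (fst (Z p)) + Im (snd (Y p)) * Im (fst (Z p)))
     - Im (fst h) / v\<^sup>2
        * (Re (snd (Y p)) * Re (snd (Z p)) + Im (snd (Y p)) * Im (snd (Z p)))) / 2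
    + g_KB p (Y' h) (Z p) + g_KB p (Y p) (Z' h))) (at p)"
proof -
  have v: "v > 0" using p by (simp add: v_def siegel_jacobi_space_iff)
  have [simp]: "Im (fst p) = v" "Im (snd p) = y" by (simp_all add: v_def y_def)
  define A B C where
    "A = (\<lambda>q :: complex \<times> complex. (Im (fst q) + (Im (snd q))\<^sup>2) / (Im (fst q))^3)" and
    "B = (\<lambda>q :: complex \<times> complex. Im (snd q) / (Im (fst q))\<^sup>2)" and
    "C = (\<lambda>q :: complex \<times> complex. 1 / Im (fst q))"
  have A: "(A has_derivative
      (\<lambda>h. (Im (fst h) + 2 * y * Im (snd h)) / v^3 - 3 * (v + y\<^sup>2) * Im (fst h) / v^4)) (at p)"
    unfolding A_def using v
    by (auto intro!: derivative_eq_intros simp: fun_eq_iff field_simps eval_nat_numeral)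
  have B: "(B has_derivative (\<lambda>h. Im (snd h) / v\<^sup>2 - 2 * y * Im (fst h) / v^3)) (at p)"
    unfolding B_def using v
    by (auto intro!: derivative_eq_intros simp: fun_eq_iff field_simps eval_nat_numeral)
  have C: "(C has_derivative (\<lambda>h. - Im (fst h) / v\<^sup>2)) (at p)"
    unfolding C_def using v
    by (auto intro!: derivative_eq_intros simp: fun_eq_iff field_simps eval_nat_numeral)
  have g: "g_KB q Y Z = (A q * (Re (fst Y) * Re (fst Z) + Im (fst Y) * Im (fst Z))
     - B q * (Re (fst Y) * Re (snd Z) + Im (fst Y) * Im (snd Z)
           + Re (snd Y) * Re (fst Z) + Im (snd Y) * Im (fst Z))
     + C q * (Re (snd Y) * Re (snd Z) + Im (snd Y) * Im (snd Z))) / 2" for q Y Z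
    unfolding g_KB_eq A_def B_def C_def ..
  \<comment> \<open>Arbitrary derivatives \<open>A'\<close>, \<open>B'\<close>, \<open>C'\<close>
    keep the coefficients opaque while the product rule is applied.\<close>
  have "((\<lambda>q. g_KB q (Y q) (Z q)) has_derivative (\<lambda>h.
      (A' h * (Re (fst (Y p)) * Re (fst (Z p)) + Im (fst (Y p)) * Im (fst (Z p)))
     - B' h * (Re (fst (Y p)) * Re (snd (Z p)) + Im (fst (Y p)) * Im (snd (Z p))
           + Re (snd (Y p)) * Re (fst (Z p)) + Im (snd (Y p)) * Im (fst (Z p)))
     + C' h * (Re (snd (Y p)) * Re (snd (Z p)) + Im (snd (Y p)) * Im (snd (Z p)))) / 2
    + g_KB p (Y' h) (Z p) + g_KB p (Y p) (Z' h))) (at p)"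
    if "(A has_derivative A') (at p)" "(B has_derivative B') (at p)" "(C has_derivative C') (at p)"
    for A' B' C'
    unfolding g
    by (rule derivative_eq_intros refl that Y Z)+ (simp_all add: fun_eq_iff field_simps)
  from this[OF A B C] show ?thesis by simp
qed

text \<open>The derivatives of \<open>Y\<close> and \<open>Z\<close> from the product rule cancel
  those in the Lie brackets. What remains is tensorial: only the values of \<open>Y\<close> and
  \<open>Z\<close> at \<open>p\<close> enter.\<close>

lemma lie_derivative_g_KB:
  assumes p: "p \<in> siegel_jacobi_space" and X: "(X has_derivative X') (at p)"
    and Y: "Y differentiable (at p)" and Z: "Z differentiable (at p)"
  defines "v \<equiv> Im (fst p)" and "y \<equiv> Im (snd p)"
  shows "lie_derivative X g_KB Y Z p =
    (((Im (fst (X p)) + 2 * y * Im (snd (X p))) / v^3 - 3 * (v + y\<^sup>2) * Im (fst (X p)) / v^4)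
        * (Re (fst (Y p)) * Re (fst (Z p)) + Im (fst (Y p)) * Im (fst (Z p)))
     - (Im (snd (X p)) / v\<^sup>2 - 2 * y * Im (fst (X p)) / v^3)
        * (Re (fst (Y p)) * Re (snd (Z p)) + Im (fst (Y p)) * Im (snd (Z p))
           + Re (snd (Y p)) * Re (fst (Z p)) + Im (snd (Y p)) * Im (fst (Z p)))
     - Im (fst (X p)) / v\<^sup>2
        * (Re (snd (Y p)) * Re (snd (Z p)) + Im (snd (Y p)) * Im (snd (Z p)))) / 2
    + g_KB p (X' (Y p)) (Z p) + g_KB p (Y p) (X' (Z p))"
proof -
  have X': "frechet_derivative X (at p) = X'"
    using X frechet_derivative_at by metis
  have diff: "g_KB p (A - B) C = g_KB p A C - g_KB p B C"
    "g_KB p C (A - B) = g_KB p C A - g_KB p C B" for A B C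
    unfolding g_KB_eq by (simp_all add: algebra_simps add_divide_distrib diff_divide_distrib)
  show ?thesis
    unfolding lie_derivative_def lie_bracket_def X' diff v_def y_def
      frechet_derivative_at[OF has_derivative_g_KB[OF p Y[unfolded frechet_derivative_works]
          Z[unfolded frechet_derivative_works]], symmetric]
    by simp
qed

section \<open>The Hamiltonian vector field and the Killing equation in coordinates\<close>

abbreviation "D\<^sub>u \<equiv> dir_deriv (1 :: complex, 0 :: complex)"
abbreviation "D\<^sub>v \<equiv> dir_deriv (\<i>, 0 :: complex)"
abbreviation "D\<^sub>x \<equiv> dir_deriv (0 :: complex, 1 :: complex)"
abbreviation "D\<^sub>y \<equiv> dir_deriv (0 :: complex, \<i>)"

lemma frechet_derivative_coords:
  assumes "f differentiable (at p)"
  shows "frechet_derivative f (at p) h =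
    Re (fst h) *\<^sub>R D\<^sub>u f p + Im (fst h) *\<^sub>R D\<^sub>v f p + Re (snd h) *\<^sub>R D\<^sub>x f p + Im (snd h) *\<^sub>R D\<^sub>y f p"
proof -
  note lin = linear_frechet_derivative[OF assms]
  have "h = Re (fst h) *\<^sub>R (1, 0) + Im (fst h) *\<^sub>R (\<i>, 0) + Re (snd h) *\<^sub>R (0, 1) + Im (snd h) *\<^sub>R (0, \<i>)"
    by (auto simp: prod_eq_iff complex_eq_iff)
  then have "frechet_derivative f (at p) h = frechet_derivative f (at p)
      (Re (fst h) *\<^sub>R (1, 0) + Im (fst h) *\<^sub>R (\<i>, 0) + Re (snd h) *\<^sub>R (0, 1) + Im (snd h) *\<^sub>R (0, \<i>))"
    by (rule arg_cong)
  then show ?thesis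
    by (simp only: linear_add[OF lin] linear_scale[OF lin] dir_deriv_def)
qed

text \<open>The right side is the witness from \<open>omega_KB_nondegenerate\<close> for the
  differential of \<open>f\<close>; uniqueness there identifies it with the definite
  description.\<close>

lemma hamiltonian_vector_field_omega_KB:
  assumes p: "p \<in> siegel_jacobi_space" and f: "f differentiable (at p)"
  defines "v \<equiv> Im (fst p)" and "y \<equiv> Im (snd p)"
  shows "hamiltonian_vector_field omega_KB f p =
    (Complex (2 * (v\<^sup>2 * D\<^sub>v f p + v * y * D\<^sub>y f p)) (- 2 * (v\<^sup>2 * D\<^sub>u f p + v * y * D\<^sub>x f p)),
     Complex (2 * (v * y * D\<^sub>v f p + (v + y\<^sup>2) * D\<^sub>y f p))
       (- 2 * (v * y * D\<^sub>u f p + (v + y\<^sup>2) * D\<^sub>x f p)))" (is "_ = ?X")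
proof -
  have v: "v > 0" using p by (simp add: v_def siegel_jacobi_space_iff)
  have [simp]: "Im (fst p) = v" "Im (snd p) = y" by (simp_all add: v_def y_def)
  have 1: "\<exists>!X. \<forall>Y. omega_KB p X Y = frechet_derivative f (at p) Y"
    by (rule omega_KB_nondegenerate[OF p linear_frechet_derivative[OF f]])
  have om: "omega_KB p X Y =
     (((v + y\<^sup>2) / v^3 * Re (fst X) - y / v\<^sup>2 * Re (snd X)) * Im (fst Y)
      - ((v + y\<^sup>2) / v^3 * Im (fst X) - y / v\<^sup>2 * Im (snd X)) * Re (fst Y)
      + (1 / v * Re (snd X) - y / v\<^sup>2 * Re (fst X)) * Im (snd Y)
      - (1 / v * Im (snd X) - y / v\<^sup>2 * Im (fst X)) * Re (snd Y)) / 2" for X Y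
    unfolding omega_KB_def g_KB_eq complex_structure_def by (simp add: algebra_simps)
  \<comment> \<open>Inversion of the coefficient matrix of the form. The versions with a minus sign
    match the imaginary parts of \<open>?X\<close>.\<close>
  have 2: "(v + y\<^sup>2) / v^3 * (2 * (v\<^sup>2 * b + v * y * l)) - y / v\<^sup>2 * (2 * (v * y * b + (v + y\<^sup>2) * l)) = 2 * b"
    "(v + y\<^sup>2) / v^3 * (- 2 * (v\<^sup>2 * b + v * y * l)) - y / v\<^sup>2 * (- 2 * (v * y * b + (v + y\<^sup>2) * l)) = - 2 * b"
    "1 / v * (2 * (v * y * b + (v + y\<^sup>2) * l)) - y / v\<^sup>2 * (2 * (v\<^sup>2 * b + v * y * l)) = 2 * l"
    "1 / v * (- 2 * (v * y * b + (v + y\<^sup>2) * l)) - y / v\<^sup>2 * (- 2 * (v\<^sup>2 * b + v * y * l)) = - 2 * l"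
    for b l
    using v by (simp_all add: field_simps power2_eq_square power3_eq_cube)
  have "\<forall>Y. omega_KB p ?X Y = frechet_derivative f (at p) Y"
    unfolding frechet_derivative_coords[OF f] om fst_conv snd_conv complex.sel 2
    by (simp add: algebra_simps)
  then show ?thesis
    unfolding hamiltonian_vector_field_def by (rule the1_equality[OF 1])
qed

lemma has_derivative_hamiltonian_vector_field:
  assumes f: "smooth_on siegel_jacobi_space f" and p: "p \<in> siegel_jacobi_space"
  defines "v \<equiv> Im (fst p)" and "y \<equiv> Im (snd p)"
    and "D \<equiv> \<lambda>w h. frechet_derivative (dir_deriv w f) (at p) h"
  shows "(hamiltonian_vector_field omega_KB f has_derivative (\<lambda>h.
    (Complex
      (2 * (2 * v * Im (fst h) * D\<^sub>v f p + v\<^sup>2 * D (\<i>, 0) h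
        + (Im (fst h) * y + v * Im (snd h)) * D\<^sub>y f p + v * y * D (0, \<i>) h))
      (- 2 * (2 * v * Im (fst h) * D\<^sub>u f p + v\<^sup>2 * D (1, 0) h
        + (Im (fst h) * y + v * Im (snd h)) * D\<^sub>x f p + v * y * D (0, 1) h)),
     Complex
      (2 * ((Im (fst h) * y + v * Im (snd h)) * D\<^sub>v f p + v * y * D (\<i>, 0) h
        + (Im (fst h) + 2 * y * Im (snd h)) * D\<^sub>y f p + (v + y\<^sup>2) * D (0, \<i>) h))
      (- 2 * ((Im (fst h) * y + v * Im (snd h)) * D\<^sub>u f p + v * y * D (1, 0) h
        + (Im (fst h) + 2 * y * Im (snd h)) * D\<^sub>x f p + (v + y\<^sup>2) * D (0, 1) h))))) (at p)"
proof -
  have D [derivative_intros]: "(dir_deriv w f has_derivative D w) (at p)" for w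
    using smooth_on_differentiable[OF smooth_on_dir_deriv[OF f] p, of w]
    by (simp add: D_def frechet_derivative_works)
  have "((\<lambda>q. (Complex (2 * ((Im (fst q))\<^sup>2 * D\<^sub>v f q + Im (fst q) * Im (snd q) * D\<^sub>y f q))
        (- 2 * ((Im (fst q))\<^sup>2 * D\<^sub>u f q + Im (fst q) * Im (snd q) * D\<^sub>x f q)),
      Complex (2 * (Im (fst q) * Im (snd q) * D\<^sub>v f q + (Im (fst q) + (Im (snd q))\<^sup>2) * D\<^sub>y f q))
        (- 2 * (Im (fst q) * Im (snd q) * D\<^sub>u f q + (Im (fst q) + (Im (snd q))\<^sup>2) * D\<^sub>x f q))))
      has_derivative (\<lambda>h.
    (Complex
      (2 * (2 * v * Im (fst h) * D\<^sub>v f p + v\<^sup>2 * D (\<i>, 0) h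
        + (Im (fst h) * y + v * Im (snd h)) * D\<^sub>y f p + v * y * D (0, \<i>) h))
      (- 2 * (2 * v * Im (fst h) * D\<^sub>u f p + v\<^sup>2 * D (1, 0) h
        + (Im (fst h) * y + v * Im (snd h)) * D\<^sub>x f p + v * y * D (0, 1) h)),
     Complex
      (2 * ((Im (fst h) * y + v * Im (snd h)) * D\<^sub>v f p + v * y * D (\<i>, 0) h
        + (Im (fst h) + 2 * y * Im (snd h)) * D\<^sub>y f p + (v + y\<^sup>2) * D (0, \<i>) h))
      (- 2 * ((Im (fst h) * y + v * Im (snd h)) * D\<^sub>u f p + v * y * D (1, 0) h
        + (Im (fst h) + 2 * y * Im (snd h)) * D\<^sub>x f p + (v + y\<^sup>2) * D (0, 1) h))))) (at p)"
    unfolding Complex_eq v_def y_def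
    by (rule derivative_eq_intros refl)+ (simp_all add: fun_eq_iff complex_eq_iff algebra_simps power2_eq_square)
  \<comment> \<open>The explicit formula agrees with the vector field on an open set only, which
    suffices for its derivative at \<open>p\<close>.\<close>
  then show ?thesis
    by (rule has_derivative_transform_within_open[OF _ open_siegel_jacobi_space p])
      (simp add: hamiltonian_vector_field_omega_KB smooth_on_differentiable[OF f])
qed

text \<open>The components of \<open>L\<^sub>X g = 0\<close>, \<open>X = X\<^sub>f\<close>, on the pairs \<open>(\<partial>\<^sub>x, \<partial>\<^sub>x)\<close>, \<open>(\<partial>\<^sub>x, \<partial>\<^sub>y)\<close>, \<open>(\<partial>\<^sub>u, \<partial>\<^sub>y)\<close>, \<open>(\<partial>\<^sub>u, \<partial>\<^sub>x)\<close>;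
  the last two are simplified by means of the first two.\<close>

lemma kaehler_function_equations:
  assumes kf: "kaehler_function siegel_jacobi_space g_KB omega_KB f" and p: "p \<in> siegel_jacobi_space"
  defines "v \<equiv> Im (fst p)" and "y \<equiv> Im (snd p)"
  shows "D\<^sub>u f p + y / v * D\<^sub>x f p = - 2 * D\<^sub>x (D\<^sub>y f) p"
    and "D\<^sub>v f p + y / v * D\<^sub>y f p = D\<^sub>x (D\<^sub>x f) p - D\<^sub>y (D\<^sub>y f) p"
    and "v * (D\<^sub>u (D\<^sub>x f) p - D\<^sub>v (D\<^sub>y f) p) + y * (D\<^sub>x (D\<^sub>x f) p - D\<^sub>y (D\<^sub>y f) p) - D\<^sub>y f p = 0"
    and "v * (D\<^sub>u (D\<^sub>y f) p + D\<^sub>v (D\<^sub>x f) p) + 2 * y * D\<^sub>x (D\<^sub>y f) p + D\<^sub>x f p = 0"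
proof -
  have v: "v > 0" using p by (simp add: v_def siegel_jacobi_space_iff)
  have [simp]: "Im (fst p) = v" "Im (snd p) = y" by (simp_all add: v_def y_def)
  have f: "smooth_on siegel_jacobi_space f" using kf by (simp add: kaehler_function_def)
  note comm = dir_deriv_commute[OF open_siegel_jacobi_space p f]
  \<comment> \<open>Normal order of mixed derivatives: u and v outermost, then x, then y.\<close>
  note [simp] = comm[of "(0, \<i>)" "(0, 1)"]
    comm[of "(0, 1)" "(1, 0)"] comm[of "(0, \<i>)" "(1, 0)"] comm[of "(0, 1)" "(\<i>, 0)"] comm[of "(0, \<i>)" "(\<i>, 0)"]
  have L: "lie_derivative (hamiltonian_vector_field omega_KB f) g_KB (\<lambda>_. Y) (\<lambda>_. Z) p = 0" for Y Z
    using kf p smooth_on_const unfolding kaehler_function_def by blast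
  note L' = L[unfolded lie_derivative_g_KB[OF p has_derivative_hamiltonian_vector_field[OF f p]
        differentiable_const differentiable_const]
      hamiltonian_vector_field_omega_KB[OF p smooth_on_differentiable[OF f p]] g_KB_eq,
      folded dir_deriv_def]
  have "D\<^sub>u f p + y / v * D\<^sub>x f p + 2 * D\<^sub>x (D\<^sub>y f) p = 0"
    \<comment> \<open>The left side equals the raw component of the Lie derivative, so what is left
      to check is an identity of expressions.\<close>
    by (rule trans[OF _ L'[of "(0, 1)" "(0, 1)"]])
      (use v in \<open>simp add: dir_deriv_def[symmetric] field_simps eval_nat_numeral\<close>)
  then show E1: "D\<^sub>u f p + y / v * D\<^sub>x f p = - 2 * D\<^sub>x (D\<^sub>y f) p"
    by simp
  have "D\<^sub>v f p + y / v * D\<^sub>y f p + D\<^sub>y (D\<^sub>y f) p - D\<^sub>x (D\<^sub>x f) p = 0"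
    by (rule trans[OF _ L'[of "(0, 1)" "(0, \<i>)"]])
      (use v in \<open>simp add: dir_deriv_def[symmetric] field_simps eval_nat_numeral\<close>)
  then show E2: "D\<^sub>v f p + y / v * D\<^sub>y f p = D\<^sub>x (D\<^sub>x f) p - D\<^sub>y (D\<^sub>y f) p"
    by simp
  have "D\<^sub>v (D\<^sub>y f) p - D\<^sub>u (D\<^sub>x f) p + D\<^sub>y f p / v - y / v * (D\<^sub>v f p + y / v * D\<^sub>y f p) = 0"
    by (rule trans[OF _ L'[of "(1, 0)" "(0, \<i>)"]])
      (use v in \<open>simp add: dir_deriv_def[symmetric] field_simps eval_nat_numeral\<close>)
  \<comment> \<open>\<open>E2\<close> replaces the first-order bracket; the factor
    \<open>- v\<close> clears the denominators.\<close>
  then have "- v * (D\<^sub>v (D\<^sub>y f) p - D\<^sub>u (D\<^sub>x f) p + D\<^sub>y f p / v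
      - y / v * (D\<^sub>x (D\<^sub>x f) p - D\<^sub>y (D\<^sub>y f) p)) = 0"
    unfolding E2 by simp
  then show "v * (D\<^sub>u (D\<^sub>x f) p - D\<^sub>v (D\<^sub>y f) p) + y * (D\<^sub>x (D\<^sub>x f) p - D\<^sub>y (D\<^sub>y f) p) - D\<^sub>y f p = 0"
    by (rule trans[rotated]) (use v in \<open>simp add: field_simps\<close>)
  have "D\<^sub>u (D\<^sub>y f) p + D\<^sub>v (D\<^sub>x f) p + D\<^sub>x f p / v - y / v * (D\<^sub>u f p + y / v * D\<^sub>x f p) = 0"
    by (rule trans[OF _ L'[of "(1, 0)" "(0, 1)"]])
      (use v in \<open>simp add: dir_deriv_def[symmetric] field_simps eval_nat_numeral\<close>)
  then have "v * (D\<^sub>u (D\<^sub>y f) p + D\<^sub>v (D\<^sub>x f) p + D\<^sub>x f p / v - y / v * (- 2 * D\<^sub>x (D\<^sub>y f) p)) = 0"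
    unfolding E1 by simp
  then show "v * (D\<^sub>u (D\<^sub>y f) p + D\<^sub>v (D\<^sub>x f) p) + 2 * y * D\<^sub>x (D\<^sub>y f) p + D\<^sub>x f p = 0"
    by (rule trans[rotated]) (use v in \<open>simp add: field_simps\<close>)
qed

section \<open>Fibre derivatives of a Killing potential\<close>

lemma dir_deriv_funpow_smooth:
  "smooth_on S f \<Longrightarrow> smooth_on S ((dir_deriv w ^^ n) f)"
  by (induction n) (auto intro: smooth_on_dir_deriv)

text \<open>The suffixes name the components of the Killing equation from which the four equations
  stem.\<close>

locale killing_potential =
  fixes f :: "complex \<times> complex \<Rightarrow> real"
  assumes smooth: "smooth_on siegel_jacobi_space f"
    and eq_xx: "p \<in> siegel_jacobi_space \<Longrightarrow>
      D\<^sub>u f p + Im (snd p) / Im (fst p) * D\<^sub>x f p = - 2 * D\<^sub>x (D\<^sub>y f) p"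
    and eq_xy: "p \<in> siegel_jacobi_space \<Longrightarrow>
      D\<^sub>v f p + Im (snd p) / Im (fst p) * D\<^sub>y f p = D\<^sub>x (D\<^sub>x f) p - D\<^sub>y (D\<^sub>y f) p"
    and eq_uy: "p \<in> siegel_jacobi_space \<Longrightarrow>
      Im (fst p) * (D\<^sub>u (D\<^sub>x f) p - D\<^sub>v (D\<^sub>y f) p)
      + Im (snd p) * (D\<^sub>x (D\<^sub>x f) p - D\<^sub>y (D\<^sub>y f) p) - D\<^sub>y f p = 0"
    and eq_ux: "p \<in> siegel_jacobi_space \<Longrightarrow>
      Im (fst p) * (D\<^sub>u (D\<^sub>y f) p + D\<^sub>v (D\<^sub>x f) p)
      + 2 * Im (snd p) * D\<^sub>x (D\<^sub>y f) p + D\<^sub>x f p = 0"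
begin

text \<open>With the y-derivatives innermost, a further x-derivative is a matter of definition; a
  further y-derivative must be moved inwards by symmetry.\<close>

definition J :: "nat \<Rightarrow> nat \<Rightarrow> complex \<times> complex \<Rightarrow> real" where
  "J c d = (D\<^sub>x ^^ c) ((D\<^sub>y ^^ d) f)"

lemma smooth_J: "smooth_on siegel_jacobi_space (J c d)"
  unfolding J_def by (intro dir_deriv_funpow_smooth smooth)

lemma diff_J [simp]: "p \<in> siegel_jacobi_space \<Longrightarrow> J c d differentiable (at p)"
  by (rule smooth_on_differentiable[OF smooth_J])

lemma diff_dir_deriv_J [simp]: "p \<in> siegel_jacobi_space \<Longrightarrow> dir_deriv w (J c d) differentiable (at p)"
  by (rule smooth_on_differentiable[OF smooth_on_dir_deriv[OF smooth_J]])

lemma J_x: "D\<^sub>x (J c d) = J (Suc c) d"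
  by (simp add: J_def)

lemma J_y: "p \<in> siegel_jacobi_space \<Longrightarrow> D\<^sub>y (J c d) p = J c (Suc d) p"
proof (induction c arbitrary: p)
  case (Suc c)
  have "D\<^sub>y (J (Suc c) d) p = D\<^sub>x (D\<^sub>y (J c d)) p"
    unfolding J_x[symmetric] by (rule dir_deriv_commute[OF open_siegel_jacobi_space Suc.prems smooth_J])
  also have "\<dots> = D\<^sub>x (J c (Suc d)) p"
    by (rule dir_deriv_cong[OF open_siegel_jacobi_space Suc.prems]) (use Suc in auto)
  finally show ?case by (simp add: J_x)
qed (simp add: J_def)

lemma dir_deriv_J_x:
  "p \<in> siegel_jacobi_space \<Longrightarrow> D\<^sub>x (dir_deriv w (J c d)) p = dir_deriv w (J (Suc c) d) p"
  by (simp add: dir_deriv_commute[OF open_siegel_jacobi_space _ smooth_J, of _ "(0, 1)" w] J_x)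

lemma dir_deriv_J_y:
  assumes "p \<in> siegel_jacobi_space"
  shows "D\<^sub>y (dir_deriv w (J c d)) p = dir_deriv w (J c (Suc d)) p"
proof -
  have "D\<^sub>y (dir_deriv w (J c d)) p = dir_deriv w (D\<^sub>y (J c d)) p"
    by (rule dir_deriv_commute[OF open_siegel_jacobi_space assms smooth_J])
  also have "\<dots> = dir_deriv w (J c (Suc d)) p"
    by (rule dir_deriv_cong[OF open_siegel_jacobi_space assms]) (use assms J_y in auto)
  finally show ?thesis .
qed

text \<open>A line in the fibre never leaves the space, so an identity valid on the space can be
  differentiated along it at time 0. Its formula stays hidden: only the behaviour of the
  coefficients and the derivative rule are exported.\<close>

lemma vertical_line:
  assumes p: "p \<in> siegel_jacobi_space"
  obtains L :: "real \<Rightarrow> complex \<times> complex" where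
    "L 0 = p" "\<And>t. L t \<in> siegel_jacobi_space"
    "\<And>t. Im (fst (L t)) = Im (fst p)" "\<And>t. Im (snd (L t)) = Im (snd p) + t * Im z"
    "\<And>G :: complex \<times> complex \<Rightarrow> real. G differentiable (at p) \<Longrightarrow>
      ((\<lambda>t. G (L t)) has_real_derivative dir_deriv (0, z) G p) (at 0)"
proof
  let ?L = "\<lambda>t. p + t *\<^sub>R (0, z)"
  show "?L 0 = p" by (simp add: prod_eq_iff)
  show "?L t \<in> siegel_jacobi_space" "Im (fst (?L t)) = Im (fst p)"
    "Im (snd (?L t)) = Im (snd p) + t * Im z" for t
    using p by (simp_all add: siegel_jacobi_space_iff)
  show "((\<lambda>t. G (?L t)) has_real_derivative dir_deriv (0, z) G p) (at 0)"
    if "G differentiable (at p)" for G :: "complex \<times> complex \<Rightarrow> real"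
    using has_real_derivative_dir_deriv[of G p 0 "(0, z)"] that by (simp del: scaleR_Pair)
qed

section \<open>Fibre derivatives of the Killing equations\<close>

text \<open>Leibniz rule for \<open>eq_xx\<close>: the coefficient y / v is affine in y, so
  \<open>d\<close> differentiations in y add just one term, with factor
  \<open>real d / Im (fst p)\<close>. For \<open>d = 0\<close> this factor cancels the truncated
  \<open>d - 1\<close>.\<close>

lemma eq_xx_jet:
  "p \<in> siegel_jacobi_space \<Longrightarrow>
    D\<^sub>u (J c d) p + Im (snd p) / Im (fst p) * J (Suc c) d p + real d / Im (fst p) * J (Suc c) (d - 1) p
    = - 2 * J (Suc c) (Suc d) p"
proof (induction c arbitrary: p)
  case 0
  then show ?case
  proof (induction d arbitrary: p)
    case 0
    then show ?case using eq_xx[OF 0] by (simp add: J_def)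
  next
    case (Suc d)
    note p = Suc.prems
    obtain L where L: "L 0 = p" "\<And>t. L t \<in> siegel_jacobi_space"
      "\<And>t. Im (fst (L t)) = Im (fst p)" "\<And>t. Im (snd (L t)) = Im (snd p) + t * Im \<i>"
      and [derivative_intros]: "\<And>G :: complex \<times> complex \<Rightarrow> real. G differentiable (at p) \<Longrightarrow>
        ((\<lambda>t. G (L t)) has_real_derivative D\<^sub>y G p) (at 0)"
      using vertical_line[OF p, of \<i>] by blast
    have nz: "Im (fst p) \<noteq> 0" using p by (simp add: siegel_jacobi_space_iff)
    have "((\<lambda>t. D\<^sub>u (J 0 d) (L t) + (Im (snd p) + t) / Im (fst p) * J (Suc 0) d (L t)
        + real d / Im (fst p) * J (Suc 0) (d - 1) (L t))
      has_real_derivative D\<^sub>y (D\<^sub>u (J 0 d)) p + (1 / Im (fst p) * J (Suc 0) d p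
        + Im (snd p) / Im (fst p) * D\<^sub>y (J (Suc 0) d) p)
        + real d / Im (fst p) * D\<^sub>y (J (Suc 0) (d - 1)) p) (at 0)"
      by (rule derivative_eq_intros refl diff_J diff_dir_deriv_J p nz)+ (simp add: L(1) nz mult.commute)
    moreover have "((\<lambda>t. - 2 * J (Suc 0) (Suc d) (L t))
      has_real_derivative - 2 * D\<^sub>y (J (Suc 0) (Suc d)) p) (at 0)"
      by (rule derivative_eq_intros refl diff_J p)+ simp
    moreover have "D\<^sub>u (J 0 d) (L t) + (Im (snd p) + t) / Im (fst p) * J (Suc 0) d (L t)
        + real d / Im (fst p) * J (Suc 0) (d - 1) (L t) = - 2 * J (Suc 0) (Suc d) (L t)" for t
      using Suc.IH[OF L(2), of t] by (simp add: L(3,4))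
    ultimately have "D\<^sub>y (D\<^sub>u (J 0 d)) p + (1 / Im (fst p) * J (Suc 0) d p
        + Im (snd p) / Im (fst p) * D\<^sub>y (J (Suc 0) d) p)
        + real d / Im (fst p) * D\<^sub>y (J (Suc 0) (d - 1)) p = - 2 * D\<^sub>y (J (Suc 0) (Suc d)) p"
      by (simp only: DERIV_unique)
    then show ?case
      \<comment> \<open>The case split resolves \<open>d - 1\<close>: for a successor, the old
        Leibniz term and the new one combine to the factor \<open>real (Suc d)\<close>.\<close>
      by (cases d) (simp_all add: dir_deriv_J_y J_y p algebra_simps add_divide_distrib)
  qed
next
  case (Suc c)
  note p = Suc.prems
  \<comment> \<open>Since \<open>Im 1 = 0\<close>, the coefficient y / v is constant along this line
    and contributes no new term.\<close>
  obtain L where L: "L 0 = p" "\<And>t. L t \<in> siegel_jacobi_space"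
    "\<And>t. Im (fst (L t)) = Im (fst p)" "\<And>t. Im (snd (L t)) = Im (snd p) + t * Im 1"
    and [derivative_intros]: "\<And>G :: complex \<times> complex \<Rightarrow> real. G differentiable (at p) \<Longrightarrow>
      ((\<lambda>t. G (L t)) has_real_derivative D\<^sub>x G p) (at 0)"
    using vertical_line[OF p, of 1] by blast
  have "((\<lambda>t. D\<^sub>u (J c d) (L t) + Im (snd p) / Im (fst p) * J (Suc c) d (L t)
      + real d / Im (fst p) * J (Suc c) (d - 1) (L t))
    has_real_derivative D\<^sub>x (D\<^sub>u (J c d)) p + Im (snd p) / Im (fst p) * D\<^sub>x (J (Suc c) d) p
      + real d / Im (fst p) * D\<^sub>x (J (Suc c) (d - 1)) p) (at 0)"
    by (rule derivative_eq_intros refl diff_J diff_dir_deriv_J p)+ (simp add: mult.commute)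
  moreover have "((\<lambda>t. - 2 * J (Suc c) (Suc d) (L t))
    has_real_derivative - 2 * D\<^sub>x (J (Suc c) (Suc d)) p) (at 0)"
    by (rule derivative_eq_intros refl diff_J p)+ simp
  moreover have "D\<^sub>u (J c d) (L t) + Im (snd p) / Im (fst p) * J (Suc c) d (L t)
      + real d / Im (fst p) * J (Suc c) (d - 1) (L t) = - 2 * J (Suc c) (Suc d) (L t)" for t
    using Suc.IH[OF L(2), of t] by (simp add: L(3,4))
  ultimately have "D\<^sub>x (D\<^sub>u (J c d)) p + Im (snd p) / Im (fst p) * D\<^sub>x (J (Suc c) d) p
      + real d / Im (fst p) * D\<^sub>x (J (Suc c) (d - 1)) p = - 2 * D\<^sub>x (J (Suc c) (Suc d)) p"
    by (simp only: DERIV_unique)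
  then show ?case by (simp add: J_x dir_deriv_J_x p)
qed

text \<open>Same Leibniz argument; here the coefficient multiplies a y-derivative, so the extra term
  is \<open>J c d\<close> itself.\<close>

lemma eq_xy_jet:
  "p \<in> siegel_jacobi_space \<Longrightarrow>
    D\<^sub>v (J c d) p + Im (snd p) / Im (fst p) * J c (Suc d) p + real d / Im (fst p) * J c d p
    = J (Suc (Suc c)) d p - J c (Suc (Suc d)) p"
proof (induction c arbitrary: p)
  case 0
  then show ?case
  proof (induction d arbitrary: p)
    case 0
    then show ?case using eq_xy[OF 0] by (simp add: J_def)
  next
    case (Suc d)
    note p = Suc.prems
    obtain L where L: "L 0 = p" "\<And>t. L t \<in> siegel_jacobi_space"
      "\<And>t. Im (fst (L t)) = Im (fst p)" "\<And>t. Im (snd (L t)) = Im (snd p) + t * Im \<i>"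
      and [derivative_intros]: "\<And>G :: complex \<times> complex \<Rightarrow> real. G differentiable (at p) \<Longrightarrow>
        ((\<lambda>t. G (L t)) has_real_derivative D\<^sub>y G p) (at 0)"
      using vertical_line[OF p, of \<i>] by blast
    have nz: "Im (fst p) \<noteq> 0" using p by (simp add: siegel_jacobi_space_iff)
    have "((\<lambda>t. D\<^sub>v (J 0 d) (L t) + (Im (snd p) + t) / Im (fst p) * J 0 (Suc d) (L t)
        + real d / Im (fst p) * J 0 d (L t))
      has_real_derivative D\<^sub>y (D\<^sub>v (J 0 d)) p + (1 / Im (fst p) * J 0 (Suc d) p
        + Im (snd p) / Im (fst p) * D\<^sub>y (J 0 (Suc d)) p)
        + real d / Im (fst p) * D\<^sub>y (J 0 d) p) (at 0)"
      by (rule derivative_eq_intros refl diff_J diff_dir_deriv_J p nz)+ (simp add: L(1) nz mult.commute)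
    moreover have "((\<lambda>t. J (Suc (Suc 0)) d (L t) - J 0 (Suc (Suc d)) (L t))
      has_real_derivative D\<^sub>y (J (Suc (Suc 0)) d) p - D\<^sub>y (J 0 (Suc (Suc d))) p) (at 0)"
      by (rule derivative_eq_intros refl diff_J p)+
    moreover have "D\<^sub>v (J 0 d) (L t) + (Im (snd p) + t) / Im (fst p) * J 0 (Suc d) (L t)
        + real d / Im (fst p) * J 0 d (L t) = J (Suc (Suc 0)) d (L t) - J 0 (Suc (Suc d)) (L t)" for t
      using Suc.IH[OF L(2), of t] by (simp add: L(3,4))
    ultimately have "D\<^sub>y (D\<^sub>v (J 0 d)) p + (1 / Im (fst p) * J 0 (Suc d) p
        + Im (snd p) / Im (fst p) * D\<^sub>y (J 0 (Suc d)) p)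
        + real d / Im (fst p) * D\<^sub>y (J 0 d) p = D\<^sub>y (J (Suc (Suc 0)) d) p - D\<^sub>y (J 0 (Suc (Suc d))) p"
      by (simp only: DERIV_unique)
    then show ?case
      by (simp add: dir_deriv_J_y J_y p algebra_simps add_divide_distrib)
  qed
next
  case (Suc c)
  note p = Suc.prems
  obtain L where L: "L 0 = p" "\<And>t. L t \<in> siegel_jacobi_space"
    "\<And>t. Im (fst (L t)) = Im (fst p)" "\<And>t. Im (snd (L t)) = Im (snd p) + t * Im 1"
    and [derivative_intros]: "\<And>G :: complex \<times> complex \<Rightarrow> real. G differentiable (at p) \<Longrightarrow>
      ((\<lambda>t. G (L t)) has_real_derivative D\<^sub>x G p) (at 0)"
    using vertical_line[OF p, of 1] by blast
  have "((\<lambda>t. D\<^sub>v (J c d) (L t) + Im (snd p) / Im (fst p) * J c (Suc d) (L t)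
      + real d / Im (fst p) * J c d (L t))
    has_real_derivative D\<^sub>x (D\<^sub>v (J c d)) p + Im (snd p) / Im (fst p) * D\<^sub>x (J c (Suc d)) p
      + real d / Im (fst p) * D\<^sub>x (J c d) p) (at 0)"
    by (rule derivative_eq_intros refl diff_J diff_dir_deriv_J p)+ (simp add: mult.commute)
  moreover have "((\<lambda>t. J (Suc (Suc c)) d (L t) - J c (Suc (Suc d)) (L t))
    has_real_derivative D\<^sub>x (J (Suc (Suc c)) d) p - D\<^sub>x (J c (Suc (Suc d))) p) (at 0)"
    by (rule derivative_eq_intros refl diff_J p)+
  moreover have "D\<^sub>v (J c d) (L t) + Im (snd p) / Im (fst p) * J c (Suc d) (L t)
      + real d / Im (fst p) * J c d (L t) = J (Suc (Suc c)) d (L t) - J c (Suc (Suc d)) (L t)" for t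
    using Suc.IH[OF L(2), of t] by (simp add: L(3,4))
  ultimately have "D\<^sub>x (D\<^sub>v (J c d)) p + Im (snd p) / Im (fst p) * D\<^sub>x (J c (Suc d)) p
      + real d / Im (fst p) * D\<^sub>x (J c d) p = D\<^sub>x (J (Suc (Suc c)) d) p - D\<^sub>x (J c (Suc (Suc d))) p"
    by (simp only: DERIV_unique)
  then show ?case by (simp add: J_x dir_deriv_J_x p)
qed

text \<open>Inserting the jets of orders (1, 0) and (0, 1) into \<open>eq_uy\<close> and
  \<open>eq_ux\<close> cancels all terms of order one and two.\<close>

lemma cubic:
  assumes p: "p \<in> siegel_jacobi_space"
  shows "J 0 3 p = 3 * J 2 1 p" "J 3 0 p = 3 * J 1 2 p"
proof -
  have v: "Im (fst p) > 0" using p by (simp add: siegel_jacobi_space_iff)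
  have 1: "D\<^sub>u (J 1 0) p = - 2 * J 2 1 p - Im (snd p) / Im (fst p) * J 2 0 p"
    "D\<^sub>v (J 0 1) p = J 2 1 p - J 0 3 p - Im (snd p) / Im (fst p) * J 0 2 p - J 0 1 p / Im (fst p)"
    "D\<^sub>u (J 0 1) p = - 2 * J 1 2 p - Im (snd p) / Im (fst p) * J 1 1 p - J 1 0 p / Im (fst p)"
    "D\<^sub>v (J 1 0) p = J 3 0 p - J 1 2 p - Im (snd p) / Im (fst p) * J 1 1 p"
    using eq_xx_jet[OF p, of 1 0] eq_xy_jet[OF p, of 0 1] eq_xx_jet[OF p, of 0 1] eq_xy_jet[OF p, of 1 0]
    by (simp_all add: eval_nat_numeral)
  have "Im (fst p) * (D\<^sub>u (J 1 0) p - D\<^sub>v (J 0 1) p) + Im (snd p) * (J 2 0 p - J 0 2 p) - J 0 1 p = 0"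
    "Im (fst p) * (D\<^sub>u (J 0 1) p + D\<^sub>v (J 1 0) p) + 2 * Im (snd p) * J 1 1 p + J 1 0 p = 0"
    using eq_uy[OF p] eq_ux[OF p] by (simp_all add: J_def eval_nat_numeral)
  then have "Im (fst p) * (J 0 3 p - 3 * J 2 1 p) = 0" "Im (fst p) * (J 3 0 p - 3 * J 1 2 p) = 0"
    unfolding 1 using v by (simp_all add: field_simps)
  then show "J 0 3 p = 3 * J 2 1 p" "J 3 0 p = 3 * J 1 2 p"
    using v by simp_all
qed

sublocale killing_jet "\<lambda>c d u v x y. J c d (Complex u v, Complex x y)"
proof
  fix c d :: nat and u v x y :: real assume v: "v > 0"
  let ?p = "(Complex u v, Complex x y)"
  have p [simp]: "(Complex u' v, z) \<in> siegel_jacobi_space" for u' z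
    using v by (simp add: siegel_jacobi_space_iff)
  note deriv = has_real_derivative_dir_deriv[of "J c d"]
  show "((\<lambda>x. J c d (Complex u v, Complex x y)) has_real_derivative J (Suc c) d ?p) (at x)"
    \<comment> \<open>The base point has the moving coordinate set to 0, so the line parameter is
      that coordinate itself.\<close>
    using deriv[of "(Complex u v, Complex 0 y)" x "(0, 1)"]
    by (simp add: J_x[symmetric] Complex_eq algebra_simps scaleR_conv_of_real p[unfolded Complex_eq])
  show "((\<lambda>y. J c d (Complex u v, Complex x y)) has_real_derivative J c (Suc d) ?p) (at y)"
    using deriv[of "(Complex u v, Complex x 0)" y "(0, \<i>)"]
    by (simp add: J_y[symmetric] Complex_eq algebra_simps scaleR_conv_of_real p[unfolded Complex_eq])
  have "((\<lambda>u. J c d (Complex u v, Complex x y)) has_real_derivative D\<^sub>u (J c d) ?p) (at u)"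
    using deriv[of "(Complex 0 v, Complex x y)" u "(1, 0)"]
    by (simp add: Complex_eq algebra_simps scaleR_conv_of_real p[unfolded Complex_eq])
  moreover have "D\<^sub>u (J c d) ?p =
      - 2 * J (Suc c) (Suc d) ?p - y / v * J (Suc c) d ?p - real d / v * J (Suc c) (d - 1) ?p"
    using eq_xx_jet[of ?p c d] by (simp add: algebra_simps)
  ultimately show "((\<lambda>u. J c d (Complex u v, Complex x y)) has_real_derivative
      - 2 * J (Suc c) (Suc d) ?p - y / v * J (Suc c) d ?p - real d / v * J (Suc c) (d - 1) ?p) (at u)"
    by (simp only:)
  have "((\<lambda>v. J c d (Complex u v, Complex x y)) has_real_derivative D\<^sub>v (J c d) ?p) (at v)"
    \<comment> \<open>This base point lies on the boundary \<open>v = 0\<close>; differentiability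
      is needed only at the point reached.\<close>
    using deriv[of "(Complex u 0, Complex x y)" v "(\<i>, 0)"]
    by (simp add: Complex_eq algebra_simps scaleR_conv_of_real p[unfolded Complex_eq])
  moreover have "D\<^sub>v (J c d) ?p =
      J (Suc (Suc c)) d ?p - J c (Suc (Suc d)) ?p - y / v * J c (Suc d) ?p - real d / v * J c d ?p"
    using eq_xy_jet[of ?p c d] by (simp add: algebra_simps)
  ultimately show "((\<lambda>v. J c d (Complex u v, Complex x y)) has_real_derivative
      J (Suc (Suc c)) d ?p - J c (Suc (Suc d)) ?p - y / v * J c (Suc d) ?p - real d / v * J c d ?p) (at v)"
    by (simp only:)
  show "J 0 3 ?p = 3 * J 2 1 ?p" "J 3 0 ?p = 3 * J 1 2 ?p"
    using cubic by simp_all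
qed

end

section \<open>The potentials of the Jacobi group action\<close>

text \<open>The general solution found in \<open>solution\<close>, written with z = q + s \<tau>: a
  quadratic polynomial in \<open>q\<close> and \<open>s\<close> plus a function on the
  half-plane.\<close>

definition sj_potential :: "real \<Rightarrow> real \<Rightarrow> real \<Rightarrow> real \<Rightarrow> real \<Rightarrow> real \<Rightarrow> complex \<times> complex \<Rightarrow> real" where
  "sj_potential a b c e k m p =
    (let u = Re (fst p); v = Im (fst p); s = Im (snd p) / v; q = Re (snd p) - u * s
     in a * q\<^sup>2 / 2 + b * q * s + c * s\<^sup>2 / 2 + e * q + k * s
        + a * (u\<^sup>2 + v\<^sup>2) / v - 2 * b * u / v + c / v + m)"

text \<open>In these coordinates \<eta>1 = s / 2 and \<eta>2 = s^2 / 4 + 1 / (2 v), so the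
  coefficients can be matched; the reciprocal term in the G-component is simply v / 2.\<close>

lemma momentum_map_eq_sj_potential:
  assumes "p \<in> siegel_jacobi_space"
  shows "momentum_map p (A, \<alpha>, \<beta>, r) =
    sj_potential (A$2$1 / 2) (A$1$1 / 2) (- A$1$2 / 2) (- \<alpha> / 2) (\<beta> / 2) (- r / 4) p"
proof -
  define v where "v = Im (fst p)"
  have v: "v > 0" using assms by (simp add: siegel_jacobi_space_iff v_def)
  have [simp]: "Im (fst p) = v" by (simp add: v_def)
  have eta: "(\<eta>\<^sub>1 p)\<^sup>2 - \<eta>\<^sub>2 p = - 1 / (2 * v)"
    using v by (simp add: \<eta>\<^sub>1_def \<eta>\<^sub>2_def \<theta>\<^sub>1_def \<theta>\<^sub>2_def field_simps power2_eq_square)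
  have 1: "1 / (4 * ((\<eta>\<^sub>1 p)\<^sup>2 - \<eta>\<^sub>2 p)) = - v / 2"
    unfolding eta using v by simp
  show ?thesis
    unfolding momentum_map_def case_prod_conv 1
    using v by (simp add: sj_potential_def Let_def \<eta>\<^sub>1_def \<eta>\<^sub>2_def \<theta>\<^sub>1_def \<theta>\<^sub>2_def d\<theta>\<^sub>1_def d\<theta>\<^sub>2_def
        field_simps power2_eq_square)
qed

lemma has_derivative_sj_potential:
  assumes p: "p \<in> siegel_jacobi_space"
  defines "u \<equiv> Re (fst p)" and "v \<equiv> Im (fst p)" and "s \<equiv> Im (snd p) / Im (fst p)"
    and "q \<equiv> Re (snd p) - Re (fst p) * (Im (snd p) / Im (fst p))"
  shows "(sj_potential a b c e k m has_derivative (\<lambda>h.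
    (a * q + b * s + e) * (Re (snd h) - Re (fst h) * s - u * ((Im (snd h) - s * Im (fst h)) / v))
    + (b * q + c * s + k) * ((Im (snd h) - s * Im (fst h)) / v)
    + 2 * (a * u - b) * Re (fst h) / v
    + (a - (a * u\<^sup>2 - 2 * b * u + c) / v\<^sup>2) * Im (fst h))) (at p)"
proof -
  have v: "v > 0" using p by (simp add: siegel_jacobi_space_iff v_def)
  have [simp]: "Im (fst p) = v" "Re (fst p) = u" by (simp_all add: v_def u_def)
  define S where "S = (\<lambda>p :: complex \<times> complex. Im (snd p) / Im (fst p))"
  have S: "(S has_derivative (\<lambda>h. (Im (snd h) - s * Im (fst h)) / v)) (at p)"
    unfolding S_def s_def using v
    by (auto intro!: derivative_eq_intros simp: fun_eq_iff field_simps)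
  have Sp: "S p = s" by (simp add: S_def s_def)
  define Q where "Q = (\<lambda>p. Re (snd p) - Re (fst p) * S p)"
  have Q: "(Q has_derivative (\<lambda>h. Re (snd h) - Re (fst h) * s - u * ((Im (snd h) - s * Im (fst h)) / v))) (at p)"
    unfolding Q_def
    by (rule derivative_eq_intros refl S)+ (simp add: fun_eq_iff algebra_simps Sp)
  have Qp: "Q p = q" by (simp add: Q_def S_def q_def)
  define W where "W = (\<lambda>p :: complex \<times> complex. a * ((Re (fst p))\<^sup>2 + (Im (fst p))\<^sup>2) / Im (fst p)
    - 2 * b * Re (fst p) / Im (fst p) + c / Im (fst p))"
  have W: "(W has_derivative (\<lambda>h. 2 * (a * u - b) * Re (fst h) / v
    + (a - (a * u\<^sup>2 - 2 * b * u + c) / v\<^sup>2) * Im (fst h))) (at p)"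
    unfolding W_def using v
    by (auto intro!: derivative_eq_intros simp: fun_eq_iff field_simps power2_eq_square)
  have eq: "sj_potential a b c e k m = (\<lambda>p. a * (Q p)\<^sup>2 / 2 + b * Q p * S p + c * (S p)\<^sup>2 / 2 + e * Q p
      + k * S p + W p + m)"
    by (simp add: fun_eq_iff sj_potential_def Let_def Q_def S_def W_def)
  have two: "(2::real) \<noteq> 0" by simp
  \<comment> \<open>The chain rule is again applied to opaque \<open>Q\<close>, \<open>S\<close> and
    \<open>W\<close>.\<close>
  have "((\<lambda>p. a * (Q p)\<^sup>2 / 2 + b * Q p * S p + c * (S p)\<^sup>2 / 2 + e * Q p + k * S p + W p + m)
      has_derivative (\<lambda>h. (a * q + b * s + e) * Q' h + (b * q + c * s + k) * S' h + W' h)) (at p)"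
    if "(Q has_derivative Q') (at p)" "(S has_derivative S') (at p)" "(W has_derivative W') (at p)"
    for Q' S' W'
    by (rule derivative_eq_intros refl that two)+ (simp add: fun_eq_iff field_simps Qp Sp)
  from this[OF Q S W] show ?thesis
    unfolding eq by (simp add: add.assoc)
qed

section \<open>The potentials generate Killing fields\<close>

lemma hamiltonian_vector_field_sj_potential:
  assumes f: "\<And>p. p \<in> siegel_jacobi_space \<Longrightarrow> f p = sj_potential a b c e k m p"
    and p: "p \<in> siegel_jacobi_space"
  shows "hamiltonian_vector_field omega_KB f p =
    (- 2 * c + 4 * b * fst p - 2 * a * (fst p)\<^sup>2,
     2 * (b * snd p - a * fst p * snd p + k - e * fst p))"
proof -
  define u v y s x where "u = Re (fst p)" and "v = Im (fst p)" and "y = Im (snd p)"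
    and "s = y / v" and "x = Re (snd p)"
  have v: "v > 0" using p by (simp add: siegel_jacobi_space_iff v_def)
  \<comment> \<open>Writing y as \<open>s * v\<close> avoids nested quotients in the final
    comparison.\<close>
  have y: "y = s * v" using v by (simp add: s_def)
  have D: "(f has_derivative (\<lambda>h.
    (a * (x - u * s) + b * s + e) * (Re (snd h) - Re (fst h) * s - u * ((Im (snd h) - s * Im (fst h)) / v))
    + (b * (x - u * s) + c * s + k) * ((Im (snd h) - s * Im (fst h)) / v)
    + 2 * (a * u - b) * Re (fst h) / v
    + (a - (a * u\<^sup>2 - 2 * b * u + c) / v\<^sup>2) * Im (fst h))) (at p)"
    by (rule has_derivative_transform_within_open[OF _ open_siegel_jacobi_space p f[symmetric]])
      (use has_derivative_sj_potential[OF p] in \<open>simp_all add: u_def v_def s_def x_def y_def\<close>)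
  have d: "D\<^sub>u f p = - (a * (x - u * s) + b * s + e) * s + 2 * (a * u - b) / v"
    "D\<^sub>v f p = (a * (x - u * s) + b * s + e) * (u * s / v) - (b * (x - u * s) + c * s + k) * s / v
      + (a - (a * u\<^sup>2 - 2 * b * u + c) / v\<^sup>2)"
    "D\<^sub>x f p = a * (x - u * s) + b * s + e"
    "D\<^sub>y f p = (b * (x - u * s) + c * s + k - u * (a * (x - u * s) + b * s + e)) / v"
    unfolding dir_deriv_def frechet_derivative_at[OF D, symmetric]
    by (simp_all add: algebra_simps diff_divide_distrib add_divide_distrib)
  have f': "f differentiable (at p)" using D by (rule differentiableI)
  show ?thesis
    unfolding hamiltonian_vector_field_omega_KB[OF p f'] d v_def[symmetric] y_def[symmetric] y
    using v by (simp add: prod_eq_iff complex_eq_iff v_def[symmetric] y_def[symmetric]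
        u_def[symmetric] x_def[symmetric] y field_simps power2_eq_square)
qed

lemma kaehler_function_sj_potential:
  assumes smooth: "smooth_on siegel_jacobi_space f"
    and f: "\<And>p. p \<in> siegel_jacobi_space \<Longrightarrow> f p = sj_potential a b c e k m p"
  shows "kaehler_function siegel_jacobi_space g_KB omega_KB f"
  unfolding kaehler_function_def
proof (intro conjI allI impI ballI smooth)
  fix Y Z :: "complex \<times> complex \<Rightarrow> complex \<times> complex" and p
  assume Y: "smooth_on siegel_jacobi_space Y" and Z: "smooth_on siegel_jacobi_space Z"
    and p: "p \<in> siegel_jacobi_space"
  let ?X = "hamiltonian_vector_field omega_KB f"
  have ham: "?X p = (- 2 * c + 4 * b * fst p - 2 * a * (fst p)\<^sup>2,
     2 * (b * snd p - a * fst p * snd p + k - e * fst p))" if "p \<in> siegel_jacobi_space" for p :: "complex \<times> complex"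
    by (rule hamiltonian_vector_field_sj_potential[OF _ that]) (rule f)
  define v s where "v = Im (fst p)" and "s = Im (snd p) / v"
  have v: "v > 0" using p by (simp add: siegel_jacobi_space_iff v_def)
  have y: "Im (snd p) = s * v" using v by (simp add: s_def)
  \<comment> \<open>Real and imaginary parts: w1 + i w2 = 2 (b - a \<tau>) and C1 + i s w2 = - 2 (a
    z + e), the entries of the complex Jacobian of the field up to a factor 2 in the first.\<close>
  define w1 w2 C1 where "w1 = 2 * (b - a * Re (fst p))" and "w2 = - 2 * a * v"
    and "C1 = - 2 * (a * Re (snd p) + e)"
  define X' where "X' = (\<lambda>h :: complex \<times> complex. (2 * Complex w1 w2 * fst h,
    Complex w1 w2 * snd h + Complex C1 (s * w2) * fst h))"
  have X'_eq: "X' = (\<lambda>h. (4 * (b - a * fst p) * fst h,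
      2 * ((b - a * fst p) * snd h - (a * snd p + e) * fst h)))"
    by (simp add: X'_def fun_eq_iff complex_eq_iff w1_def w2_def C1_def y v_def[symmetric] algebra_simps)
  have "((\<lambda>p :: complex \<times> complex. (- 2 * c + 4 * b * fst p - 2 * a * (fst p)\<^sup>2,
     2 * (b * snd p - a * fst p * snd p + k - e * fst p))) has_derivative X') (at p)"
    unfolding X'_eq by (rule derivative_eq_intros refl)+ (simp add: fun_eq_iff algebra_simps)
  then have X': "(?X has_derivative X') (at p)"
    by (rule has_derivative_transform_within_open[OF _ open_siegel_jacobi_space p])
      (simp add: ham)
  have X: "Im (fst (?X p)) = 2 * v * w1" "Im (snd (?X p)) = v * (w1 * s + C1)"
    unfolding ham[OF p]
    by (simp_all add: w1_def C1_def y v_def[symmetric] power2_eq_square algebra_simps)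
  \<comment> \<open>In terms of \<open>\<alpha>\<close>, \<open>\<gamma>\<close> and
    \<open>s * \<gamma>\<close>, the metric coefficients up to the factor 1/2, their derivatives
    along the field are linear in \<open>w1\<close> and \<open>C1\<close>. All powers of
    \<open>v\<close> thus disappear and the terms cancel algebraically.\<close>
  define \<alpha> \<gamma> where "\<alpha> = (v + (s * v)\<^sup>2) / v ^ 3" and "\<gamma> = 1 / v"
  have \<beta>: "s * v / v\<^sup>2 = s * \<gamma>"
    using v by (simp add: \<gamma>_def field_simps eval_nat_numeral)
  have d: "(2 * v * w1 + 2 * (s * v) * (v * (w1 * s + C1))) / v ^ 3 - 3 * (v + (s * v)\<^sup>2) * (2 * v * w1) / v ^ 4
      = - 4 * \<alpha> * w1 + 2 * s * \<gamma> * C1"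
    "v * (w1 * s + C1) / v\<^sup>2 - 2 * (s * v) * (2 * v * w1) / v ^ 3 = - 3 * s * \<gamma> * w1 + \<gamma> * C1"
    "2 * v * w1 / v\<^sup>2 = 2 * \<gamma> * w1"
    using v by (simp_all add: \<alpha>_def \<gamma>_def field_simps eval_nat_numeral)
  show "lie_derivative ?X g_KB Y Z p = 0"
    unfolding lie_derivative_g_KB[OF p X' smooth_on_differentiable[OF Y p] smooth_on_differentiable[OF Z p]]
      g_KB_eq v_def[symmetric] y X d \<alpha>_def[symmetric] \<gamma>_def[symmetric] \<beta>
    by (simp add: X'_def field_simps)
qed

section \<open>Both directions combined\<close>

lemma kaehler_function_imp_sj_potential:
  assumes "kaehler_function siegel_jacobi_space g_KB omega_KB f"
  obtains a b c e k m where "\<And>p. p \<in> siegel_jacobi_space \<Longrightarrow> f p = sj_potential a b c e k m p"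
proof -
  interpret killing_potential f
    using assms kaehler_function_equations[OF assms]
    by unfold_locales (auto simp: kaehler_function_def)
  obtain a b c e k m where sol: "\<And>u v x y. v > 0 \<Longrightarrow> J 0 0 (Complex u v, Complex x y) =
      a * (x - u * y / v)\<^sup>2 / 2 + b * (x - u * y / v) * (y / v) + c * (y / v)\<^sup>2 / 2
      + e * (x - u * y / v) + k * (y / v) + a * (u\<^sup>2 + v\<^sup>2) / v - 2 * b * u / v + c / v + m"
    using solution by blast
  show thesis
  proof (rule that)
    fix p assume "p \<in> siegel_jacobi_space"
    then show "f p = sj_potential a b c e k m p"
      using sol[of "Im (fst p)" "Re (fst p)" "Re (snd p)" "Im (snd p)"]
      by (simp add: siegel_jacobi_space_iff J_def sj_potential_def Let_def)
  qed
qed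

theorem corollary3p43:
  fixes f :: "complex \<times> complex \<Rightarrow> real"
  assumes "smooth_on siegel_jacobi_space f"
  shows "kaehler_function siegel_jacobi_space g_KB omega_KB f \<longleftrightarrow>
    (\<exists>L\<in>jacobi_lie_algebra. \<forall>p\<in>siegel_jacobi_space. f p = momentum_map p L)"
proof
  assume "kaehler_function siegel_jacobi_space g_KB omega_KB f"
  then obtain a b c e k m where
    f: "\<And>p. p \<in> siegel_jacobi_space \<Longrightarrow> f p = sj_potential a b c e k m p"
    using kaehler_function_imp_sj_potential by blast
  \<comment> \<open>Inverts the parameters of \<open>momentum_map_eq_sj_potential\<close>; the lower
    right entry makes the trace zero.\<close>
  define A :: "real ^ 2 ^ 2" where "A = vector [vector [2 * b, - 2 * c], vector [2 * a, - 2 * b]]"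
  have "(A, - 2 * e, 2 * k, - 4 * m) \<in> jacobi_lie_algebra"
    by (simp add: jacobi_lie_algebra_def A_def trace_def sum_2)
  moreover have "f p = momentum_map p (A, - 2 * e, 2 * k, - 4 * m)" if "p \<in> siegel_jacobi_space" for p :: "complex \<times> complex"
    unfolding f[OF that] momentum_map_eq_sj_potential[OF that] by (simp add: A_def)
  ultimately show "\<exists>L\<in>jacobi_lie_algebra. \<forall>p\<in>siegel_jacobi_space. f p = momentum_map p L"
    by blast
next
  assume "\<exists>L\<in>jacobi_lie_algebra. \<forall>p\<in>siegel_jacobi_space. f p = momentum_map p L"
  then obtain A \<alpha> \<beta> r where "\<And>p. p \<in> siegel_jacobi_space \<Longrightarrow> f p = momentum_map p (A, \<alpha>, \<beta>, r)"
    by (metis prod_cases4)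
  then have "f p = sj_potential (A$2$1 / 2) (A$1$1 / 2) (- A$1$2 / 2) (- \<alpha> / 2) (\<beta> / 2) (- r / 4) p"
    if "p \<in> siegel_jacobi_space" for p :: "complex \<times> complex"
    using that by (simp only: momentum_map_eq_sj_potential)
  with assms show "kaehler_function siegel_jacobi_space g_KB omega_KB f"
    by (rule kaehler_function_sj_potential)
qed

end
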